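(* Let $\Gamma$ be an $(n,d)$-complex with $n\ge d+2$ and let $\overline\Gamma$ be its complement complex. Then: (1) if $\overline\Gamma$ is regular then $\Gamma$ is positively decorable; (2) if $\Gamma$ is positively decorable then $\overline\Gamma$ is either regular or (isomorphic to) the boundary complex of a simplicial polytope; if the latter happens then $\overline\Gamma$ minus a facet is regular.
   Context: An $(n,d)$-complex is a finite set $\Gamma$ of subsets of $[n]=\{1,\dots,n\}$ of cardinality $d+1$, called facets. Its complement $\overline\Gamma$ is the $(n,n-d-2)$-complex with facets $[n]\setminus\tau$, $\tau\in\Gamma$. An $(n,e)$-complex is regular if it is isomorphic to a (perhaps non-proper) subcomplex of a regular triangulation of some point configuration in $\mathbb R^e$; a triangulation of a configuration $\mathcal A$ (a triangulation of $\mathrm{conv}(\mathcal A)$ with vertices in $\mathcal A$) is regular if there is a convex function on $\mathrm{conv}(\mathcal A)$ which is affine on each simplex but not affine on the union of two different facets. $\Gamma$ is positively decorable if there is a real $d\times n$ matrix $C$ such that for every facet $\tau\in\Gamma$ the $d\times(d+1)$ submatrix of $C$ formed by the columns indexed by $\tau$ is positively spanning. A $d\times(d+1)$ real matrix $M$ is positively spanning if all the values $(-1)^i\,\mathrm{minor}(M,i)$, $1\le i\le d+1$, are nonzero and have the same sign, where $\mathrm{minor}(M,i)$ is the determinant of $M$ with its $i$-th column removed. *)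

theory Defs
  imports
    "HOL-Analysis.Analysis"
    "Jordan_Normal_Form.Determinant"
    "Jordan_Normal_Form.DL_Submatrix"
begin

text \<open>An \<open>(n,d)\<close>-complex is given by its facets; elements of \<open>{1..n}\<close> that lie in no facet
  are allowed.\<close>

definition nd_complex :: "nat \<Rightarrow> nat \<Rightarrow> nat set set \<Rightarrow> bool" where
  "nd_complex n d \<Gamma> \<longleftrightarrow> finite \<Gamma> \<and> (\<forall>\<tau>\<in>\<Gamma>. \<tau> \<subseteq> {1..n} \<and> card \<tau> = d + 1)"

definition complement_complex :: "nat \<Rightarrow> nat set set \<Rightarrow> nat set set" where
  "complement_complex n \<Gamma> = (\<lambda>\<tau>. {1..n} - \<tau>) ` \<Gamma>"

text \<open>Both complexes are given by the vertex sets of their facets, and \<open>f\<close> relabels the vertices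
  that occur in some facet of \<open>\<Delta>\<close>.\<close>

definition isomorphic_to_subcomplex :: "'v set set \<Rightarrow> 'w set set \<Rightarrow> bool" where
  "isomorphic_to_subcomplex \<Delta> \<Delta>' \<longleftrightarrow> (\<exists>f. inj_on f (\<Union>\<Delta>) \<and> (`) f ` \<Delta> \<subseteq> \<Delta>')"

definition isomorphic_complexes :: "'v set set \<Rightarrow> 'w set set \<Rightarrow> bool" where
  "isomorphic_complexes \<Delta> \<Delta>' \<longleftrightarrow> (\<exists>f. inj_on f (\<Union>\<Delta>) \<and> (`) f ` \<Delta> = \<Delta>')"

definition vertices_of :: "'a::euclidean_space set \<Rightarrow> 'a set" where
  "vertices_of P = {x. x extreme_point_of P}"

definition triangulation_of :: "'a::euclidean_space set set \<Rightarrow> 'a set \<Rightarrow> bool" where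
  "triangulation_of K A \<longleftrightarrow>
     simplicial_complex K \<and> \<Union>K = convex hull A \<and> (\<forall>S\<in>K. vertices_of S \<subseteq> A)"

definition maximal_simplices :: "'a::euclidean_space set set \<Rightarrow> 'a set set" where
  "maximal_simplices K = {S \<in> K. \<forall>T\<in>K. S \<subseteq> T \<longrightarrow> T = S}"

text \<open>On a set that need not be convex, being affine means being the restriction of an affine
  function on the whole space.\<close>

definition affine_function_on :: "'a::euclidean_space set \<Rightarrow> ('a \<Rightarrow> real) \<Rightarrow> bool" where
  "affine_function_on S h \<longleftrightarrow> (\<exists>l c. linear l \<and> (\<forall>x\<in>S. h x = l x + c))"

definition regular_triangulation_of :: "'a::euclidean_space set set \<Rightarrow> 'a set \<Rightarrow> bool" where
  "regular_triangulation_of K A \<longleftrightarrow>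
     triangulation_of K A \<and>
     (\<exists>h. convex_on (convex hull A) h \<and>
          (\<forall>S\<in>K. affine_function_on S h) \<and>
          (\<forall>S\<in>maximal_simplices K. \<forall>T\<in>maximal_simplices K.
              S \<noteq> T \<longrightarrow> \<not> affine_function_on (S \<union> T) h))"

text \<open>There is no Euclidean space type of dimension \<open>0\<close>, and \<open>e = 0\<close> must be covered. So
  \<open>\<real>\<^sup>e\<close> is represented by an \<open>e\<close>-dimensional linear subspace \<open>E\<close> of an ambient Euclidean space
  \<open>'a\<close>; this is meant for \<open>DIM('a) \<ge> e\<close>, and then does not depend on the choice of \<open>'a\<close> and \<open>E\<close>.\<close>

definition regular_complex :: "'a::euclidean_space itself \<Rightarrow> nat \<Rightarrow> nat set set \<Rightarrow> bool" where
  "regular_complex (_ :: 'a itself) e \<Delta> \<longleftrightarrow>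
     (\<exists>(E :: 'a set) A K. subspace E \<and> dim E = e \<and> finite A \<and> A \<subseteq> E \<and>
        regular_triangulation_of K A \<and>
        isomorphic_to_subcomplex \<Delta> (vertices_of ` maximal_simplices K))"

definition simplicial_polytope :: "'a::euclidean_space set \<Rightarrow> bool" where
  "simplicial_polytope P \<longleftrightarrow> polytope P \<and> (\<forall>F. F facet_of P \<longrightarrow> (\<exists>k. k simplex F))"

text \<open>The polytope is full-dimensional in \<open>'a\<close>. Its facets are given by their vertex sets.\<close>

definition simplicial_polytope_boundary :: "'a::euclidean_space itself \<Rightarrow> nat set set \<Rightarrow> bool" where
  "simplicial_polytope_boundary (_ :: 'a itself) \<Delta> \<longleftrightarrow>
     (\<exists>P :: 'a set. simplicial_polytope P \<and> aff_dim P = int DIM('a) \<and>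
        isomorphic_complexes \<Delta> (vertices_of ` {F. F facet_of P}))"

text \<open>Matrix columns are numbered from \<open>0\<close> in the library and from \<open>1\<close> here: \<open>i\<close> denotes the
  column with library index \<open>i - 1\<close>.\<close>

definition column_minor :: "real mat \<Rightarrow> nat \<Rightarrow> real" where
  "column_minor M i = Determinant.det (submatrix M UNIV (- {i - 1}))"

definition positively_spanning :: "nat \<Rightarrow> real mat \<Rightarrow> bool" where
  "positively_spanning d M \<longleftrightarrow> M \<in> carrier_mat d (d + 1) \<and>
     (\<exists>s. s \<noteq> 0 \<and> (\<forall>i\<in>{1..d + 1}. sgn ((-1) ^ i * column_minor M i) = s))"

definition positively_decorable :: "nat \<Rightarrow> nat \<Rightarrow> nat set set \<Rightarrow> bool" where
  "positively_decorable n d \<Gamma> \<longleftrightarrow>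
     (\<exists>C \<in> carrier_mat d n. \<forall>\<tau>\<in>\<Gamma>. positively_spanning d (submatrix C UNIV {j. Suc j \<in> \<tau>}))"

end

(* Gale duality. The kernel of a decoration C, divided by a strictly positive kernel vector, is the
   space of affine functions on a configuration of n points in dimension n - d - 1; C is positively
   spanning on the columns tau iff the points outside tau are affinely independent and span a
   hyperplane that has the points of tau strictly on one side. So Gamma is positively decorable
   iff all facets of its complement are simplicial facets of the convex hull of one configuration.
   Lifting a regular triangulation by its convex function produces such a configuration. Conversely,
   perturb the configuration into general position: if the complement does not exhaust the boundary
   of the resulting simplicial polytope, the Schlegel diagram based on a missing facet is a regular
   triangulation that contains it. *)
theory Submission
  imports Defs
begin

section \<open>Positively spanning matrices in terms of their kernels\<close>

text \<open>The link between the sign condition and geometry is that the signed minors form a kernel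
  vector of a d by d+1 matrix: equal nonzero signs mean that the kernel is a line spanned by a
  strictly positive vector. Extended by zero and divided, this vector is an affine function that
  vanishes exactly at the points outside \<tau>. The definition of regularity compares only pairs of
  maximal simplices, whereas a lifting needs the affine function of each simplex to stay strictly
  below the lifted position of every other vertex; getting from the first to the second is the main
  analytic step. In the converse direction the hull may have further facets, unrelated to \<Gamma>,
  and a Schlegel diagram is a triangulation only if the facets other than its base are simplices;
  hence the general position. The ambient space has dimension n - d - 1, the size of a facet of the
  complement, and the regular triangulation lives in a hyperplane of it, possibly of dimension 0. If
  \<Gamma> is empty, there is no facet from which to build an affine basis, so that case is treated
  apart.\<close>

lemma pick_Compl_singleton: "pick (- {k}) j = (if j < k then j else Suc j)"
proof -
  let ?i = "if j < k then j else Suc j"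
  have "{a \<in> - {k}. a < ?i} = (if j < k then {..<j} else {..<Suc j} - {k})"
    by auto
  then have "card {a \<in> - {k}. a < ?i} = j"
    by (simp add: not_less)
  then show ?thesis
    using pick_card_in_set[of ?i "- {k}"] by (auto split: if_splits)
qed

lemma bij_betw_skip:
  assumes "k < Suc d"
  shows "bij_betw (\<lambda>j. if j < k then j else Suc j) {..<d} ({..<Suc d} - {k})"
proof (rule bij_betwI[where g = "\<lambda>j. if j < k then j else j - 1"])
qed (use assms in \<open>auto split: if_splits\<close>)

lemma submatrix_Compl_singleton:
  assumes "M \<in> carrier_mat d (Suc d)" "k < Suc d"
  shows "submatrix M UNIV (- {k}) = mat d d (\<lambda>(r, j). M $$ (r, if j < k then j else Suc j))"
proof -
  have "{j. j < Suc d \<and> j \<in> - {k}} = {..<Suc d} - {k}"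
    by auto
  then show ?thesis
    using assms unfolding submatrix_def by (simp add: pick_UNIV pick_Compl_singleton)
qed

text \<open>Repeat row \<open>r\<close> on top of \<open>M\<close> and expand the vanishing determinant along the new row.\<close>

lemma sum_column_minor_eq_0:
  assumes M: "M \<in> carrier_mat d (Suc d)" and r: "r < d"
  shows "(\<Sum>k<Suc d. M $$ (r, k) * ((-1) ^ k * column_minor M (Suc k))) = 0"
proof -
  define A where "A = mat (Suc d) (Suc d) (\<lambda>(a, b). if a = 0 then M $$ (r, b) else M $$ (a - 1, b))"
  have A: "A \<in> carrier_mat (Suc d) (Suc d)"
    by (simp add: A_def)
  have "row A 0 = row A (Suc r)"
    using r by (intro eq_vecI) (auto simp: A_def)
  then have "Determinant.det A = 0"
    using det_identical_rows[OF A, of 0 "Suc r"] r by simp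
  moreover have "mat_delete A 0 k = submatrix M UNIV (- {k})" if "k < Suc d" for k
    using that M by (subst submatrix_Compl_singleton) (auto simp: mat_delete_def A_def)
  ultimately show ?thesis
    using laplace_expansion_row[OF A, of 0]
    by (simp add: cofactor_def column_minor_def A_def del: sum.lessThan_Suc cong: sum.cong_simp)
qed

text \<open>Inserting a zero at \<open>k\<close> turns the kernel vectors of the square matrix
  without column \<open>k\<close> into the kernel vectors of \<open>M\<close> with entry zero at
  \<open>k\<close>, and the minor vanishes exactly when there is a nonzero one.\<close>

lemma column_minor_eq_0_iff:
  assumes M: "M \<in> carrier_mat d (Suc d)" and k: "k < Suc d"
  shows "column_minor M (Suc k) = 0 \<longleftrightarrow>
    (\<exists>x. (\<forall>r<d. (\<Sum>j<Suc d. M $$ (r, j) * x j) = 0) \<and> x k = 0 \<and> (\<exists>j<Suc d. x j \<noteq> (0::real)))"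
proof -
  let ?s = "\<lambda>j. if j < k then j else Suc j"
  let ?B = "mat d d (\<lambda>(r, j). M $$ (r, ?s j))"
  have bij: "bij_betw ?s {..<d} ({..<Suc d} - {k})"
    using bij_betw_skip[OF k] .
  have sum: "(\<Sum>j<Suc d. M $$ (r, j) * x j) = (\<Sum>j<d. M $$ (r, ?s j) * x (?s j))"
    if "x k = 0" for r and x :: "nat \<Rightarrow> real"
  proof -
    have "(\<Sum>j<Suc d. M $$ (r, j) * x j) = (\<Sum>j\<in>{..<Suc d} - {k}. M $$ (r, j) * x j)"
      using that by (intro sum.mono_neutral_right) auto
    also have "\<dots> = (\<Sum>j<d. M $$ (r, ?s j) * x (?s j))"
      using sum.reindex_bij_betw[OF bij, of "\<lambda>j. M $$ (r, j) * x j"] by simp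
    finally show ?thesis .
  qed
  have "column_minor M (Suc k) = 0 \<longleftrightarrow> Determinant.det ?B = 0"
    using submatrix_Compl_singleton[OF assms] by (simp add: column_minor_def)
  also have "\<dots> \<longleftrightarrow> (\<exists>v. v \<in> carrier_vec d \<and> v \<noteq> 0\<^sub>v d \<and> ?B *\<^sub>v v = 0\<^sub>v d)"
    by (rule det_0_iff_vec_prod_zero) simp
  also have "\<dots> \<longleftrightarrow> (\<exists>x. (\<forall>r<d. (\<Sum>j<Suc d. M $$ (r, j) * x j) = 0) \<and> x k = 0 \<and> (\<exists>j<Suc d. x j \<noteq> (0::real)))"
    (is "?L \<longleftrightarrow> ?R")
  proof
    assume ?L
    then obtain v where v: "v \<in> carrier_vec d" "v \<noteq> 0\<^sub>v d" "?B *\<^sub>v v = 0\<^sub>v d"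
      by blast
    define x where "x j = (if j = k then 0 else v $ (if j < k then j else j - 1))" for j
    have xs: "x (?s j) = v $ j" for j
      by (auto simp: x_def)
    have "(\<Sum>j<Suc d. M $$ (r, j) * x j) = 0" if "r < d" for r
    proof -
      have "(?B *\<^sub>v v) $ r = 0"
        using v that by simp
      then have "(\<Sum>j<d. M $$ (r, ?s j) * v $ j) = 0"
        using that v(1) by (simp add: scalar_prod_def lessThan_atLeast0 cong: sum.cong_simp)
      then show ?thesis
        by (subst sum) (simp add: x_def, simp add: xs del: if_distrib)
    qed
    moreover have "\<exists>j<Suc d. x j \<noteq> 0"
    proof -
      obtain j where "j < d" "v $ j \<noteq> 0"
        using v(1,2) by (metis carrier_vecD eq_vecI index_zero_vec(1,2))
      then show ?thesis
        using xs[of j] by (intro exI[of _ "?s j"]) auto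
    qed
    ultimately show ?R
      by (intro exI[of _ x]) (auto simp: x_def)
  next
    assume ?R
    then obtain x j where x: "\<forall>r<d. (\<Sum>j<Suc d. M $$ (r, j) * x j) = 0" "x k = 0" "j < Suc d" "x j \<noteq> 0"
      by blast
    define v where "v = vec d (\<lambda>j. x (?s j))"
    have "?B *\<^sub>v v = 0\<^sub>v d"
    proof (rule eq_vecI)
      fix r assume "r < dim_vec (0\<^sub>v d :: real Matrix.vec)"
      then have r: "r < d" by simp
      have "(?B *\<^sub>v v) $ r = (\<Sum>j<d. M $$ (r, ?s j) * x (?s j))"
        using r by (simp add: v_def scalar_prod_def lessThan_atLeast0 cong: sum.cong_simp)
      also have "\<dots> = 0"
        using r x(1) sum[where x = x, OF x(2)] by metis
      finally show "(?B *\<^sub>v v) $ r = 0\<^sub>v d $ r"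
        using r by simp
    qed simp
    moreover have "v \<noteq> 0\<^sub>v d"
    proof -
      have "j \<in> ?s ` {..<d}"
        using x bij by (auto simp: bij_betw_def)
      then obtain i where "i < d" "j = ?s i"
        by auto
      then have "v $ i \<noteq> 0\<^sub>v d $ i"
        using x(4) by (simp add: v_def del: if_split_asm)
      then show ?thesis
        by auto
    qed
    ultimately show ?L
      by (intro exI[of _ v]) (auto simp: v_def)
  qed
  finally show ?thesis .
qed

text \<open>The signed minors \<open>m\<close> are a kernel vector of \<open>M\<close>. The second
  condition says that no entry of \<open>m\<close> is zero; together with the first it makes
  \<open>m\<close> a multiple of a positive vector, which is the equality of signs. From here on
  kernels replace minors.\<close>

lemma positively_spanning_iff_kernel:
  assumes M: "M \<in> carrier_mat d (Suc d)"
  shows "positively_spanning d M \<longleftrightarrow>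
    (\<exists>y. (\<forall>j<Suc d. y j > 0) \<and> (\<forall>r<d. (\<Sum>j<Suc d. M $$ (r, j) * y j) = 0)) \<and>
    (\<forall>x. (\<forall>r<d. (\<Sum>j<Suc d. M $$ (r, j) * x j) = 0) \<and> (\<exists>j<Suc d. x j = 0) \<longrightarrow> (\<forall>j<Suc d. x j = (0::real)))"
    (is "_ \<longleftrightarrow> ?P \<and> ?Q")
proof -
  define m where "m k = (-1) ^ k * column_minor M (Suc k)" for k
  have ker: "(\<Sum>j<Suc d. M $$ (r, j) * m j) = 0" if "r < d" for r
    using sum_column_minor_eq_0[OF M that] by (simp add: m_def)
  have m0: "m k = 0 \<longleftrightarrow>
    (\<exists>x. (\<forall>r<d. (\<Sum>j<Suc d. M $$ (r, j) * x j) = 0) \<and> x k = 0 \<and> (\<exists>j<Suc d. x j \<noteq> (0::real)))"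
    if "k < Suc d" for k
    using column_minor_eq_0_iff[OF M that] by (simp add: m_def)
  have Q: "?Q \<longleftrightarrow> (\<forall>k<Suc d. m k \<noteq> 0)"
    using m0 by blast
  \<comment> \<open>The definition counts columns from 1, so its sign at column \<open>Suc k\<close>
    is opposite to the sign used in \<open>m k\<close>.\<close>
  have ps: "positively_spanning d M \<longleftrightarrow> (\<exists>s. s \<noteq> 0 \<and> (\<forall>k<Suc d. sgn (- m k) = s))"
  proof -
    have "(\<forall>i\<in>{1..d + 1}. sgn ((-1) ^ i * column_minor M i) = s) \<longleftrightarrow> (\<forall>k<Suc d. sgn (- m k) = s)" for s
    proof -
      have "{1..d + 1} = Suc ` {..<Suc d}"
        by (simp add: lessThan_atLeast0 flip: atLeastLessThanSuc_atLeastAtMost)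
      then show ?thesis
        by (simp only: m_def) auto
    qed
    then show ?thesis
      using M by (simp add: positively_spanning_def)
  qed
  show ?thesis
  proof
    assume "positively_spanning d M"
    then obtain s where s: "s \<noteq> 0" "\<And>k. k < Suc d \<Longrightarrow> sgn (- m k) = s"
      using ps by blast
    have "m k \<noteq> 0" if "k < Suc d" for k
      using s(1) s(2)[OF that] by auto
    then have "?Q"
      unfolding Q by blast
    moreover have ?P
    \<comment> \<open>Since \<open>s\<close> is the common sign of the numbers \<open>- m k\<close>,
      the product \<open>- s * m k\<close> is the absolute value of \<open>m k\<close>.\<close>
    proof (intro exI[of _ "\<lambda>k. - s * m k"] conjI allI impI)
      fix k assume "k < Suc d"
      then show "0 < - s * m k"
        using s(1) s(2)[of k] by (auto simp: sgn_real_def split: if_splits)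
    next
      fix r assume "r < d"
      have "(\<Sum>j<Suc d. M $$ (r, j) * (- s * m j)) = - s * (\<Sum>j<Suc d. M $$ (r, j) * m j)"
        by (simp only: sum_distrib_left) (simp add: algebra_simps)
      then show "(\<Sum>j<Suc d. M $$ (r, j) * (- s * m j)) = 0"
        using ker[OF \<open>r < d\<close>] by simp
    qed
    ultimately show "?P \<and> ?Q" by blast
  next
    assume PQ: "?P \<and> ?Q"
    then obtain y where y: "\<And>j. j < Suc d \<Longrightarrow> y j > 0" "\<And>r. r < d \<Longrightarrow> (\<Sum>j<Suc d. M $$ (r, j) * y j) = 0"
      by blast
    \<comment> \<open>With this \<open>t\<close> the kernel vector \<open>m - t * y\<close> has
      entry zero at 0, so by the second condition it vanishes identically.\<close>
    define t where "t = m 0 / y 0"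
    have "(\<forall>r<d. (\<Sum>j<Suc d. M $$ (r, j) * (m j - t * y j)) = 0)"
    proof (intro allI impI)
      fix r assume "r < d"
      have "(\<Sum>j<Suc d. M $$ (r, j) * (m j - t * y j))
          = (\<Sum>j<Suc d. M $$ (r, j) * m j) - t * (\<Sum>j<Suc d. M $$ (r, j) * y j)"
        by (simp only: sum_distrib_left sum_subtractf[symmetric]) (simp add: algebra_simps)
      then show "(\<Sum>j<Suc d. M $$ (r, j) * (m j - t * y j)) = 0"
        using ker y(2) \<open>r < d\<close> by simp
    qed
    moreover have "m 0 - t * y 0 = 0"
      using y(1)[of 0] by (simp add: t_def)
    ultimately have "\<forall>j<Suc d. m j - t * y j = 0"
      using conjunct2[OF PQ, rule_format, of "\<lambda>j. m j - t * y j"] by blast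
    then have my: "m j = t * y j" if "j < Suc d" for j
      using that by simp
    have "m 0 \<noteq> 0"
      using PQ Q by blast
    then have "t \<noteq> 0"
      using y(1)[of 0] by (simp add: t_def)
    have "sgn (- m k) = sgn (- t)" if "k < Suc d" for k
      using my[OF that] y(1)[OF that] by (simp add: sgn_mult)
    then show "positively_spanning d M"
      using ps \<open>t \<noteq> 0\<close> by (intro iffD2[OF ps] exI[of _ "sgn (- t)"]) (auto simp: sgn_zero_iff)
  qed
qed

section \<open>Columns indexed by the elements of a facet\<close>

lemma bij_betw_pick:
  assumes "\<tau> \<subseteq> {1..n}" "card \<tau> = Suc d"
  shows "bij_betw (\<lambda>j. Suc (pick {j. Suc j \<in> \<tau>} j)) {..<Suc d} \<tau>"
proof -
  let ?J = "{j. Suc j \<in> \<tau>}"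
  have tau: "\<tau> = Suc ` ?J"
    using assms(1) by (auto simp: image_iff) (metis Suc_pred atLeastAtMost_iff less_eq_Suc_le subsetD)
  have card: "card ?J = Suc d"
    using assms(2) by (subst (asm) tau) (simp add: card_image)
  then have fin: "finite ?J"
    by (metis card.infinite nat.distinct(1))
  have "inj_on (pick ?J) {..<Suc d}"
    by (rule inj_on_inverseI[where g = "\<lambda>i. card {a \<in> ?J. a < i}"]) (use card card_pick_le[of _ ?J] in simp)
  moreover have "pick ?J ` {..<Suc d} \<subseteq> ?J"
    using card pick_in_set_le[of _ ?J] by (metis (no_types, lifting) image_subsetI lessThan_iff)
  ultimately have "pick ?J ` {..<Suc d} = ?J"
    using fin card by (metis card_image card_lessThan card_subset_eq)
  then have "bij_betw (pick ?J) {..<Suc d} ?J"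
    using \<open>inj_on _ _\<close> by (simp add: bij_betw_def)
  moreover have "bij_betw Suc ?J \<tau>"
    by (subst (2) tau) (simp add: bij_betw_imageI)
  ultimately show ?thesis
    using bij_betw_trans[of "pick ?J" _ _ Suc] by (simp add: comp_def)
qed

text \<open>This is the kernel criterion with columns indexed by the elements of
  \<open>\<tau>\<close> themselves instead of by their positions in a submatrix. In Gale duality the
  same \<open>i\<close> labels a column and a point, so no reindexing is left to do there.\<close>

definition spans_positively :: "nat \<Rightarrow> (nat \<Rightarrow> nat \<Rightarrow> real) \<Rightarrow> nat set \<Rightarrow> bool" where
  "spans_positively d c \<tau> \<longleftrightarrow>
    (\<exists>y. (\<forall>i\<in>\<tau>. y i > 0) \<and> (\<forall>r<d. (\<Sum>i\<in>\<tau>. c r i * y i) = 0)) \<and>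
    (\<forall>x. (\<forall>r<d. (\<Sum>i\<in>\<tau>. c r i * x i) = 0) \<and> (\<exists>i\<in>\<tau>. x i = 0) \<longrightarrow> (\<forall>i\<in>\<tau>. x i = 0))"

lemma spans_positively_cong:
  assumes "\<And>r i. r < d \<Longrightarrow> i \<in> \<tau> \<Longrightarrow> c r i = c' r i"
  shows "spans_positively d c \<tau> \<longleftrightarrow> spans_positively d c' \<tau>"
proof -
  have "(\<forall>r<d. (\<Sum>i\<in>\<tau>. c r i * x i) = 0) \<longleftrightarrow> (\<forall>r<d. (\<Sum>i\<in>\<tau>. c' r i * x i) = 0)" for x
    using assms by (simp cong: sum.cong_simp)
  then show ?thesis
    unfolding spans_positively_def by simp
qed

lemma positively_spanning_submatrix_iff:
  assumes C: "C \<in> carrier_mat d n" and tau: "\<tau> \<subseteq> {1..n}" "card \<tau> = Suc d"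
  shows "positively_spanning d (submatrix C UNIV {j. Suc j \<in> \<tau>}) \<longleftrightarrow>
    spans_positively d (\<lambda>r i. C $$ (r, i - 1)) \<tau>"
proof -
  let ?J = "{j. Suc j \<in> \<tau>}"
  let ?M = "submatrix C UNIV ?J"
  define e where "e j = Suc (pick ?J j)" for j
  have e: "bij_betw e {..<Suc d} \<tau>"
    using bij_betw_pick[OF tau] by (simp add: e_def[abs_def])
  have "{j. j < n \<and> j \<in> ?J} = ?J"
    using tau(1) by auto
  moreover have "\<tau> = Suc ` ?J"
    using tau(1) by (auto simp: image_iff) (metis Suc_pred atLeastAtMost_iff less_eq_Suc_le subsetD)
  then have "card ?J = Suc d"
    using tau(2) card_image[of Suc ?J] by simp
  ultimately have card: "card {j. j < n \<and> j \<in> ?J} = Suc d"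
    by simp
  have M: "?M \<in> carrier_mat d (Suc d)"
    using C card by (auto simp: dim_submatrix)
  have entry: "?M $$ (r, j) = C $$ (r, e j - 1)" if "r < d" "j < Suc d" for r j
    using that C card by (subst submatrix_index) (auto simp: pick_UNIV e_def)
  have sum: "(\<Sum>j<Suc d. ?M $$ (r, j) * x (e j)) = (\<Sum>i\<in>\<tau>. C $$ (r, i - 1) * x i)"
    if "r < d" for r and x :: "nat \<Rightarrow> real"
    using sum.reindex_bij_betw[OF e, of "\<lambda>i. C $$ (r, i - 1) * x i"] that entry
    by (metis (no_types, lifting) lessThan_iff sum.cong)
  have bex_cong: "(\<exists>j<Suc d. A j) \<longleftrightarrow> (\<exists>j<Suc d. B j)" if "\<And>j. j < Suc d \<Longrightarrow> A j = B j" for A B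
    using that by blast
  \<comment> \<open>Every vector on positions factors through the bijection \<open>e\<close>, so
    quantifying over vectors on \<open>\<tau>\<close> is the same as quantifying over vectors on
    positions.\<close>
  have ex: "(\<exists>x. P (\<lambda>j. x (e j)) ) \<longleftrightarrow> (\<exists>x. P x)"
    if "\<And>x x'. (\<And>j. j < Suc d \<Longrightarrow> x j = x' j) \<Longrightarrow> P x = P x'" for P :: "(nat \<Rightarrow> real) \<Rightarrow> bool"
  proof
    assume "\<exists>x. P x"
    then obtain x where "P x" ..
    moreover have "P (\<lambda>j. (x \<circ> the_inv_into {..<Suc d} e) (e j)) = P x"
      using e by (intro that) (auto simp: bij_betw_def the_inv_into_f_f)
    ultimately show "\<exists>x. P (\<lambda>j. x (e j))"
      by blast
  qed blast
  have all: "(\<forall>i\<in>\<tau>. Q i) \<longleftrightarrow> (\<forall>j<Suc d. Q (e j))" for Q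
    using e by (auto simp: bij_betw_def)
  have bex: "(\<exists>i\<in>\<tau>. Q i) \<longleftrightarrow> (\<exists>j<Suc d. Q (e j))" for Q
    using e by (auto simp: bij_betw_def)
  let ?P = "\<lambda>y. (\<forall>j<Suc d. y j > 0) \<and> (\<forall>r<d. (\<Sum>j<Suc d. ?M $$ (r, j) * y j) = 0)"
  let ?Q = "\<lambda>x. \<not> ((\<forall>r<d. (\<Sum>j<Suc d. ?M $$ (r, j) * x j) = 0) \<and> (\<exists>j<Suc d. x j = 0)
      \<longrightarrow> (\<forall>j<Suc d. x j = (0::real)))"
  have "(\<exists>y. ?P y) \<longleftrightarrow> (\<exists>y. ?P (\<lambda>j. y (e j)))"
    by (rule ex[symmetric]) (simp del: sum.lessThan_Suc cong: sum.cong_simp)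
  also have "\<dots> \<longleftrightarrow> (\<exists>y. (\<forall>i\<in>\<tau>. y i > 0) \<and> (\<forall>r<d. (\<Sum>i\<in>\<tau>. C $$ (r, i - 1) * y i) = 0))"
    by (simp add: sum all del: sum.lessThan_Suc)
  finally have P: "(\<exists>y. ?P y) \<longleftrightarrow> (\<exists>y. (\<forall>i\<in>\<tau>. y i > 0) \<and> (\<forall>r<d. (\<Sum>i\<in>\<tau>. C $$ (r, i - 1) * y i) = 0))" .
  have "(\<exists>y. ?Q y) \<longleftrightarrow> (\<exists>y. ?Q (\<lambda>j. y (e j)))"
    by (rule ex[symmetric]) (simp del: sum.lessThan_Suc cong: sum.cong_simp bex_cong)
  also have "\<dots> \<longleftrightarrow> (\<exists>x. \<not> ((\<forall>r<d. (\<Sum>i\<in>\<tau>. C $$ (r, i - 1) * x i) = 0) \<and> (\<exists>i\<in>\<tau>. x i = 0) \<longrightarrow> (\<forall>i\<in>\<tau>. x i = 0)))"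
    by (simp add: sum all bex del: sum.lessThan_Suc)
  finally have Q: "(\<exists>x. ?Q x) \<longleftrightarrow> (\<exists>x. \<not> ((\<forall>r<d. (\<Sum>i\<in>\<tau>. C $$ (r, i - 1) * x i) = 0) \<and> (\<exists>i\<in>\<tau>. x i = 0) \<longrightarrow> (\<forall>i\<in>\<tau>. x i = 0)))" .
  show ?thesis
    unfolding positively_spanning_iff_kernel[OF M] spans_positively_def P using Q by blast
qed

lemma positively_decorable_iff:
  assumes "nd_complex n d \<Gamma>"
  shows "positively_decorable n d \<Gamma> \<longleftrightarrow> (\<exists>c. \<forall>\<tau>\<in>\<Gamma>. spans_positively d c \<tau>)"
proof -
  have tau: "\<tau> \<subseteq> {1..n}" "card \<tau> = Suc d" if "\<tau> \<in> \<Gamma>" for \<tau>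
    using assms that by (auto simp: nd_complex_def)
  show ?thesis
  proof
    assume "positively_decorable n d \<Gamma>"
    then obtain C where "C \<in> carrier_mat d n"
      "\<forall>\<tau>\<in>\<Gamma>. positively_spanning d (submatrix C UNIV {j. Suc j \<in> \<tau>})"
      by (auto simp: positively_decorable_def)
    then have "\<forall>\<tau>\<in>\<Gamma>. spans_positively d (\<lambda>r i. C $$ (r, i - 1)) \<tau>"
      using positively_spanning_submatrix_iff tau by blast
    then show "\<exists>c. \<forall>\<tau>\<in>\<Gamma>. spans_positively d c \<tau>"
      by (rule exI[of _ "\<lambda>r i. C $$ (r, i - 1)"])
  next
    assume "\<exists>c. \<forall>\<tau>\<in>\<Gamma>. spans_positively d c \<tau>"
    then obtain c where c: "\<forall>\<tau>\<in>\<Gamma>. spans_positively d c \<tau>" ..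
    define C where "C = mat d n (\<lambda>(r, i). c r (Suc i))"
    have C: "C \<in> carrier_mat d n"
      by (simp add: C_def)
    have "spans_positively d (\<lambda>r i. C $$ (r, i - 1)) \<tau>" if "\<tau> \<in> \<Gamma>" for \<tau>
    proof -
      have "C $$ (r, i - 1) = c r i" if "r < d" "i \<in> \<tau>" for r i
      proof -
        have "i - 1 < n" "Suc (i - 1) = i"
          using that tau(1)[OF \<open>\<tau> \<in> \<Gamma>\<close>] by force+
        then show ?thesis
          using that by (simp add: C_def)
      qed
      then show ?thesis
        using bspec[OF c that] spans_positively_cong[of d \<tau> "\<lambda>r i. C $$ (r, i - 1)" c] by blast
    qed
    then show "positively_decorable n d \<Gamma>"
      unfolding positively_decorable_def
      using positively_spanning_submatrix_iff[OF C] tau C by blast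
  qed
qed

text \<open>Injectivity makes the determinant nonzero, and the adjugate divided by the determinant
  produces a solution. This is how kernel vectors with prescribed coordinates are found
  later.\<close>

lemma square_system_solvable:
  fixes c :: "nat \<Rightarrow> 'i \<Rightarrow> real"
  assumes "finite J" "card J = d"
    and inj: "\<And>x. \<forall>r<d. (\<Sum>j\<in>J. c r j * x j) = 0 \<Longrightarrow> \<forall>j\<in>J. x j = 0"
  shows "\<exists>x. \<forall>r<d. (\<Sum>j\<in>J. c r j * x j) = y r"
proof -
  obtain e where e: "bij_betw e {..<d} J"
    using assms ex_bij_betw_nat_finite lessThan_atLeast0 by metis
  define B where "B = mat d d (\<lambda>(r, j). c r (e j))"
  have B: "B \<in> carrier_mat d d"
    by (simp add: B_def)
  have sum: "(\<Sum>j\<in>J. c r j * x j) = (\<Sum>j<d. c r (e j) * x (e j))" for r x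
    using sum.reindex_bij_betw[OF e, of "\<lambda>j. c r j * x j"] by simp
  define x' where "x' v j = (v :: real Matrix.vec) $ (the_inv_into {..<d} e j)" for v j
  have x': "x' v (e j) = v $ j" if "j < d" for v j
    using that e by (simp add: x'_def bij_betw_def the_inv_into_f_f)
  have Bx: "(\<Sum>j\<in>J. c r j * x' v j) = (B *\<^sub>v v) $ r" if "v \<in> carrier_vec d" "r < d" for v r
    using that by (simp add: sum x' B_def scalar_prod_def lessThan_atLeast0 cong: sum.cong_simp)
  have "Determinant.det B \<noteq> 0"
  proof
    assume "Determinant.det B = 0"
    then obtain v where v: "v \<in> carrier_vec d" "v \<noteq> 0\<^sub>v d" "B *\<^sub>v v = 0\<^sub>v d"
      using det_0_iff_vec_prod_zero[OF B] by blast
    then have "\<forall>j\<in>J. x' v j = 0"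
      using Bx by (intro inj) simp
    then have "v $ j = 0" if "j < d" for j
      using that x' e by (metis bij_betwE lessThan_iff)
    then show False
      using v by (metis carrier_vecD eq_vecI index_zero_vec)
  qed
  define v where "v = (1 / Determinant.det B) \<cdot>\<^sub>v (adj_mat B *\<^sub>v vec d y)"
  have v: "v \<in> carrier_vec d"
    using adj_mat(1)[OF B] by (simp add: v_def)
  have "B *\<^sub>v v = (1 / Determinant.det B) \<cdot>\<^sub>v (B *\<^sub>v (adj_mat B *\<^sub>v vec d y))"
    unfolding v_def using B adj_mat(1)[OF B] by (intro mult_mat_vec) auto
  also have "B *\<^sub>v (adj_mat B *\<^sub>v vec d y) = (Determinant.det B \<cdot>\<^sub>m 1\<^sub>m d) *\<^sub>v vec d y"
    using adj_mat[OF B] B by (metis assoc_mult_mat_vec vec_carrier)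
  also have "\<dots> = Determinant.det B \<cdot>\<^sub>v vec d y"
    by (intro eq_vecI) auto
  finally have "B *\<^sub>v v = vec d y"
    using \<open>Determinant.det B \<noteq> 0\<close> by (auto simp: smult_smult_assoc)
  then show ?thesis
    using Bx[OF v] by (intro exI[of _ "x' v"]) simp
qed

section \<open>Gale duality\<close>

lemma linear_functional_inner:
  fixes l :: "'a::euclidean_space \<Rightarrow> real"
  assumes "linear l"
  shows "\<exists>g. \<forall>x. l x = inner g x"
proof (intro exI allI)
  fix x
  have "l x = l (\<Sum>b\<in>Basis. inner x b *\<^sub>R b)"
    by (simp only: euclidean_representation)
  also have "\<dots> = (\<Sum>b\<in>Basis. inner x b * l b)"
    by (simp only: linear_sum[OF assms] linear_cmul[OF assms] real_scaleR_def)
  finally show "l x = inner (\<Sum>b\<in>Basis. l b *\<^sub>R b) x"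
    by (simp add: inner_sum_right inner_commute mult.commute)
qed

text \<open>Translating by one point of \<open>S\<close> makes the others linearly independent, and
  on those a linear functional can be prescribed.\<close>

lemma affine_interpolation:
  fixes S :: "'a::euclidean_space set"
  assumes "\<not> affine_dependent S"
  shows "\<exists>a b. \<forall>s\<in>S. inner a s + b = y s"
proof (cases "S = {}")
  case False
  then obtain s0 where s0: "s0 \<in> S"
    by blast
  let ?T = "(\<lambda>x. - s0 + x) ` (S - {s0})"
  have "independent ?T"
    using affine_dependent_iff_dependent2[OF s0] assms by simp
  then obtain l where l: "linear l" "\<forall>x\<in>?T. l x = y (x + s0) - y s0"
    using linear_independent_extend[of ?T "\<lambda>x. y (x + s0) - y s0"] by auto
  obtain a where la: "\<And>x. l x = inner a x"
    using linear_functional_inner[OF l(1)] by blast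
  show ?thesis
  proof (intro exI ballI)
    fix s assume "s \<in> S"
    have "inner a (s - s0) = y s - y s0"
      using l(2) \<open>s \<in> S\<close> by (cases "s = s0") (auto simp flip: la simp: linear_0[OF l(1)])
    then show "inner a s + (y s0 - inner a s0) = y s"
      by (simp add: inner_diff_right)
  qed
qed auto

text \<open>In \<open>aff_dim (p\<close> B) \<le> card (p \<open>B) - 1 \<le> card B - 1\<close>
  equality of the ends forces both equalities; the first is affine independence, the second is
  injectivity.\<close>

lemma aff_dim_image_eq_card_imp_independent:
  fixes p :: "'i \<Rightarrow> 'a::euclidean_space"
  assumes "finite B" "aff_dim (p ` B) = int (card B) - 1"
  shows "inj_on p B" "\<not> affine_dependent (p ` B)"
proof -
  have "card (p ` B) = card B"
    using aff_dim_le_card[of "p ` B"] card_image_le[of B p] assms by simp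
  then show "inj_on p B"
    using assms(1) eq_card_imp_inj_on by blast
  show "\<not> affine_dependent (p ` B)"
    using affine_independent_iff_card[of "p ` B"] assms \<open>card (p ` B) = card B\<close> by simp
qed

lemma affine_interpolation_indexed:
  fixes p :: "'i \<Rightarrow> 'a::euclidean_space"
  assumes "finite B" "aff_dim (p ` B) = int (card B) - 1"
  shows "\<exists>a b. \<forall>i\<in>B. inner a (p i) + b = y i"
proof -
  note indep = aff_dim_image_eq_card_imp_independent[OF assms]
  obtain a b where "\<forall>s\<in>p ` B. inner a s + b = y (the_inv_into B p s)"
    using affine_interpolation[OF indep(2), of "\<lambda>s. y (the_inv_into B p s)"] by blast
  then have "\<forall>i\<in>B. inner a (p i) + b = y i"
    by (simp add: the_inv_into_f_f[OF indep(1)])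
  then show ?thesis
    by blast
qed

lemma affine_functional_eq_0:
  fixes S :: "'a::euclidean_space set"
  assumes "aff_dim S = int DIM('a)" "\<And>s. s \<in> S \<Longrightarrow> inner a s + b = 0"
  shows "a = 0 \<and> b = 0"
proof -
  have "a = 0"
  proof (rule ccontr)
    assume "a \<noteq> 0"
    have "S \<subseteq> {x. inner a x = - b}"
      using assms(2) by (auto simp: eq_neg_iff_add_eq_0)
    then have "aff_dim S \<le> int DIM('a) - 1"
      using aff_dim_subset[of S "{x. inner a x = - b}"] \<open>a \<noteq> 0\<close> by simp
    then show False
      using assms(1) by simp
  qed
  moreover have "S \<noteq> {}"
    using assms(1) by auto
  ultimately show ?thesis
    using assms(2) by force
qed

text \<open>The points of \<open>\<sigma>\<close> span a hyperplane that supports the configuration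
  and contains no further point. Stated for indices, this allows points outside
  \<open>\<sigma>\<close> to coincide; for \<open>card \<sigma> = DIM('a)\<close> the dimension
  condition makes the points of \<open>\<sigma>\<close> affinely independent.\<close>

definition facet_config :: "'i set \<Rightarrow> ('i \<Rightarrow> 'a::euclidean_space) \<Rightarrow> 'i set \<Rightarrow> bool" where
  "facet_config I p \<sigma> \<longleftrightarrow> aff_dim (p ` \<sigma>) = int DIM('a) - 1 \<and>
     (\<exists>a b. (\<forall>i\<in>\<sigma>. inner a (p i) = b) \<and> (\<forall>i\<in>I - \<sigma>. inner a (p i) < b))"

text \<open>The normal is negated, so that the supporting function is positive off
  \<open>\<sigma>\<close>, as the kernel vectors of a decoration have to be.\<close>

lemma facet_configD:
  fixes p :: "'i \<Rightarrow> 'a::euclidean_space"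
  assumes "facet_config I p \<sigma>"
  shows "\<exists>a b. (\<forall>i\<in>\<sigma>. inner a (p i) + b = 0) \<and> (\<forall>i\<in>I - \<sigma>. 0 < inner a (p i) + b)"
proof -
  obtain a b where "\<And>i. i \<in> \<sigma> \<Longrightarrow> inner a (p i) = b" "\<And>i. i \<in> I - \<sigma> \<Longrightarrow> inner a (p i) < b"
    using assms unfolding facet_config_def by blast
  then show ?thesis
    by (intro exI[of _ "- a"] exI[of _ b]) auto
qed

text \<open>The point \<open>p j\<close> is off the hyperplane spanned by the facet. Such sets are
  the source of affine bases below, and of the uniqueness of affine functions.\<close>

lemma facet_config_aff_dim_insert:
  fixes p :: "'i \<Rightarrow> 'a::euclidean_space"
  assumes "facet_config I p \<sigma>" "j \<in> I - \<sigma>"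
  shows "aff_dim (p ` insert j \<sigma>) = int DIM('a)"
proof -
  obtain a b where ab: "\<And>i. i \<in> \<sigma> \<Longrightarrow> inner a (p i) = b" "\<And>i. i \<in> I - \<sigma> \<Longrightarrow> inner a (p i) < b"
    and dim: "aff_dim (p ` \<sigma>) = int DIM('a) - 1"
    using assms(1) unfolding facet_config_def by blast
  have "affine hull (p ` \<sigma>) \<subseteq> {x. inner a x = b}"
    using ab(1) by (intro hull_minimal affine_hyperplane) auto
  then have "p j \<notin> affine hull (p ` \<sigma>)"
    using ab(2)[OF assms(2)] by auto
  then show ?thesis
    using dim by (simp add: aff_dim_insert)
qed

text \<open>The rows of \<open>c\<close> are affine dependences of the points, so a vector killed by
  all of them lists the values of an affine function. The supporting function of a facet is the
  positive vector on \<open>\<tau>\<close>. A kernel vector on \<open>\<tau>\<close> with a further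
  zero is an affine function that vanishes on a facet and at a point off it, hence
  everywhere.\<close>

lemma spans_positively_if_facet_config:
  fixes p :: "nat \<Rightarrow> 'a::euclidean_space"
  assumes nd: "nd_complex n d \<Gamma>" and dim: "DIM('a) = n - d - 1" and n: "n \<ge> d + 2"
    and p: "\<And>\<tau>. \<tau> \<in> \<Gamma> \<Longrightarrow> facet_config {1..n} p ({1..n} - \<tau>)"
  shows "\<exists>c. \<forall>\<tau>\<in>\<Gamma>. spans_positively d c \<tau>"
proof (cases "\<Gamma> = {}")
  case False
  have tau: "\<tau> \<subseteq> {1..n}" "card \<tau> = Suc d" "finite \<tau>" if "\<tau> \<in> \<Gamma>" for \<tau>
    using nd that finite_subset by (auto simp: nd_complex_def)
  obtain \<tau>0 where \<tau>0: "\<tau>0 \<in> \<Gamma>"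
    using False by blast
  obtain j0 where j0: "j0 \<in> \<tau>0"
    using tau(2)[OF \<tau>0] by fastforce
  \<comment> \<open>A facet and one point off it form an affine basis of \<open>DIM('a) + 1\<close>
    points; the remaining \<open>d\<close> indices \<open>J\<close> number the rows of the
    decoration.\<close>
  define B where "B = insert j0 ({1..n} - \<tau>0)"
  define J where "J = \<tau>0 - {j0}"
  have BJ: "B \<union> J = {1..n}" "B \<inter> J = {}" "finite B" "finite J" "card J = d"
    using j0 tau[OF \<tau>0] by (auto simp: B_def J_def)
  have "aff_dim (p ` B) = int DIM('a)"
    using j0 tau(1)[OF \<tau>0] unfolding B_def by (intro facet_config_aff_dim_insert[OF p[OF \<tau>0]]) auto
  moreover have "card B = Suc DIM('a)"
    using card_Un_disjoint[OF BJ(3,4,2)] BJ(1,5) dim n by simp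
  ultimately have dimB: "aff_dim (p ` B) = int DIM('a)" "aff_dim (p ` B) = int (card B) - 1"
    by simp_all
  have "\<exists>a b. \<forall>i\<in>B. inner a (p i) + b = (if i = k then 1 else 0)" for k
    by (rule affine_interpolation_indexed[OF BJ(3) dimB(2)])
  then obtain a b where ab: "\<And>k i. i \<in> B \<Longrightarrow> inner (a k) (p i) + b k = (if i = k then 1 else 0)"
    by metis
  define bary where "bary k x = inner (a k) x + b k" for k x
  have bary: "bary k (p i) = (if i = k then 1 else 0)" if "i \<in> B" for i k
    using ab[OF that] by (simp add: bary_def)
  \<comment> \<open>The difference of the two sides is the affine function given by
    \<open>u'\<close> and \<open>v'\<close>, and it vanishes on the affine basis.\<close>
  have expand: "inner u x + v = (\<Sum>k\<in>B. bary k x * (inner u (p k) + v))" for u v x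
  proof -
    define w where "w k = inner u (p k) + v" for k
    define u' where "u' = u - (\<Sum>k\<in>B. w k *\<^sub>R a k)"
    define v' where "v' = v - (\<Sum>k\<in>B. w k * b k)"
    have eq: "inner u' x + v' = (inner u x + v) - (\<Sum>k\<in>B. bary k x * w k)" for x
      by (simp add: u'_def v'_def bary_def inner_diff_left inner_sum_left algebra_simps sum.distrib)
    have "inner u' s + v' = 0" if s: "s \<in> p ` B" for s
    proof -
      obtain i where i: "i \<in> B" "s = p i"
        using s by blast
      have "(\<Sum>k\<in>B. bary k (p i) * w k) = (\<Sum>k\<in>B. if k = i then w k else 0)"
        using i by (intro sum.cong) (auto simp: bary)
      then show ?thesis
        using i BJ(3) unfolding eq by (simp add: w_def)
    qed
    then have "u' = 0 \<and> v' = 0"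
      using affine_functional_eq_0[OF dimB(1)] by blast
    then show ?thesis
      using eq[of x] by (simp add: w_def)
  qed
  obtain e where e: "bij_betw e {..<d} J"
    using BJ(4,5) ex_bij_betw_nat_finite lessThan_atLeast0 by metis
  \<comment> \<open>row \<open>r\<close> is the affine dependence expressing \<open>p (e r)\<close> in the affine basis \<open>p ` B\<close>\<close>
  define c where "c r i = (if i = e r then 1 else if i \<in> B then - bary i (p (e r)) else 0)" for r i
  have row: "(\<Sum>i\<in>{1..n}. c r i * x i) = x (e r) - (\<Sum>k\<in>B. bary k (p (e r)) * x k)" if "r < d" for r x
  proof -
    have er: "e r \<in> J" "e r \<notin> B"
      using e that BJ(2) by (auto simp: bij_betw_def)
    have "(\<Sum>i\<in>J. c r i * x i) = (\<Sum>i\<in>J. if i = e r then x i else 0)"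
      using BJ(2) by (intro sum.cong) (auto simp: c_def)
    then have "(\<Sum>i\<in>J. c r i * x i) = x (e r)"
      using er BJ(4) by simp
    moreover have "(\<Sum>i\<in>B. c r i * x i) = - (\<Sum>k\<in>B. bary k (p (e r)) * x k)"
      unfolding sum_negf[symmetric] using er by (intro sum.cong) (auto simp: c_def)
    ultimately show ?thesis
      using sum.union_disjoint[OF BJ(3,4,2), of "\<lambda>i. c r i * x i"] BJ(1) by simp
  qed
  have sum_tau: "(\<Sum>i\<in>\<tau>. c r i * x i) = (\<Sum>i\<in>{1..n}. c r i * x i)"
    if "\<tau> \<in> \<Gamma>" "\<And>i. i \<in> {1..n} - \<tau> \<Longrightarrow> x i = 0" for \<tau> r and x :: "nat \<Rightarrow> real"
    using that tau[OF that(1)] by (intro sum.mono_neutral_left) auto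
  have "spans_positively d c \<tau>" if "\<tau> \<in> \<Gamma>" for \<tau>
    unfolding spans_positively_def
  proof (intro conjI allI impI)
    obtain u v where uv: "\<forall>i\<in>{1..n} - \<tau>. inner u (p i) + v = 0"
        "\<forall>i\<in>{1..n} - ({1..n} - \<tau>). 0 < inner u (p i) + v"
      using facet_configD[OF p[OF \<open>\<tau> \<in> \<Gamma>\<close>]] by blast
    show "\<exists>y. (\<forall>i\<in>\<tau>. y i > 0) \<and> (\<forall>r<d. (\<Sum>i\<in>\<tau>. c r i * y i) = 0)"
    proof (intro exI[of _ "\<lambda>i. inner u (p i) + v"] conjI allI impI ballI)
      fix i assume "i \<in> \<tau>"
      then show "0 < inner u (p i) + v"
        using uv(2) tau(1)[OF that] by blast
    next
      fix r assume "r < d"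
      then show "(\<Sum>i\<in>\<tau>. c r i * (inner u (p i) + v)) = 0"
        using sum_tau[OF that, of "\<lambda>i. inner u (p i) + v"] uv(1)
          row[of r "\<lambda>i. inner u (p i) + v"] expand[of u "p (e r)" v] by simp
    qed
  next
    fix x assume x: "(\<forall>r<d. (\<Sum>i\<in>\<tau>. c r i * x i) = 0) \<and> (\<exists>i\<in>\<tau>. x i = 0)"
    then obtain i0 where i0: "i0 \<in> \<tau>" "x i0 = 0"
      by blast
    \<comment> \<open>Extended by zero, \<open>x\<close> becomes a kernel vector on all of
      \<open>{1..n}\<close> and can be recognised as an affine function.\<close>
    define z where "z i = (if i \<in> \<tau> then x i else 0)" for i
    have z: "(\<Sum>i\<in>{1..n}. c r i * z i) = 0" if "r < d" for r
      using x that sum_tau[OF \<open>\<tau> \<in> \<Gamma>\<close>, of z r] by (simp add: z_def cong: sum.cong_simp)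
    obtain u v where uv: "\<forall>i\<in>B. inner u (p i) + v = z i"
      using affine_interpolation_indexed[OF BJ(3) dimB(2), of z] by blast
    have zL: "z i = inner u (p i) + v" if "i \<in> {1..n}" for i
    proof (cases "i \<in> B")
      case False
      then have "i \<in> J"
        using that BJ(1) by blast
      then obtain r where r: "r < d" "i = e r"
        using e by (auto simp: bij_betw_def)
      have "z i = (\<Sum>k\<in>B. bary k (p i) * z k)"
        using row[OF r(1), of z] z[OF r(1)] r(2) by simp
      also have "\<dots> = inner u (p i) + v"
        unfolding expand[of u "p i" v] using uv by (intro sum.cong) auto
      finally show ?thesis .
    qed (use uv in simp)
    have "i0 \<in> {1..n} - ({1..n} - \<tau>)"
      using i0 tau(1)[OF that] by blast
    then have "aff_dim (p ` insert i0 ({1..n} - \<tau>)) = int DIM('a)"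
      by (rule facet_config_aff_dim_insert[OF p[OF that]])
    moreover have "inner u s + v = 0" if "s \<in> p ` insert i0 ({1..n} - \<tau>)" for s
      using that zL i0 tau(1)[OF \<open>\<tau> \<in> \<Gamma>\<close>] by (force simp: z_def)
    ultimately have "u = 0 \<and> v = 0"
      using affine_functional_eq_0 by blast
    then show "\<forall>i\<in>\<tau>. x i = 0"
      using zL tau(1)[OF that] unfolding z_def by (smt (verit, best) inner_zero_left subsetD)
  qed
  then show ?thesis
    by blast
qed auto

lemma spans_positively_kernelD:
  assumes "spans_positively d c \<tau>" "\<forall>r<d. (\<Sum>i\<in>\<tau>. c r i * x i) = 0" "i \<in> \<tau>" "x i = 0"
  shows "\<forall>i\<in>\<tau>. x i = 0"
  using assms unfolding spans_positively_def by blast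

text \<open>One positively spanning facet already forces rank \<open>d\<close>, so the kernel is
  parametrised by \<open>DIM('a) + 1\<close> free coordinates, the number needed for affine
  functions on the ambient space. The positive vector of \<open>\<tau>\<close> then yields the
  supporting hyperplane, and the uniqueness of kernel vectors on \<open>\<tau>\<close> yields the
  dimension of the facet.\<close>

lemma facet_config_if_spans_positively:
  assumes nd: "nd_complex n d \<Gamma>" and dim: "DIM('a::euclidean_space) = n - d - 1" and n: "n \<ge> d + 2"
    and c: "\<And>\<tau>. \<tau> \<in> \<Gamma> \<Longrightarrow> spans_positively d c \<tau>"
  shows "\<exists>p :: nat \<Rightarrow> 'a. \<forall>\<tau>\<in>\<Gamma>. facet_config {1..n} p ({1..n} - \<tau>)"
proof (cases "\<Gamma> = {}")
  case False
  have tau: "\<tau> \<subseteq> {1..n}" "card \<tau> = Suc d" "finite \<tau>" if "\<tau> \<in> \<Gamma>" for \<tau>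
    using nd that finite_subset by (auto simp: nd_complex_def)
  obtain \<tau>0 where \<tau>0: "\<tau>0 \<in> \<Gamma>"
    using False by blast
  obtain j0 where j0: "j0 \<in> \<tau>0"
    using tau(2)[OF \<tau>0] by fastforce
  define B where "B = insert j0 ({1..n} - \<tau>0)"
  define J where "J = \<tau>0 - {j0}"
  have BJ: "B \<union> J = {1..n}" "B \<inter> J = {}" "finite B" "finite J" "card J = d"
    using j0 tau[OF \<tau>0] by (auto simp: B_def J_def)
  have cardB: "card B = Suc DIM('a)"
    using card_Un_disjoint[OF BJ(3,4,2)] BJ(1,5) dim n by simp
  \<comment> \<open>A dependence among the columns in \<open>J\<close> is a kernel vector on
    \<open>\<tau>0\<close> with entry zero at \<open>j0\<close>.\<close>
  have inj: "\<forall>j\<in>J. x j = 0" if x: "\<forall>r<d. (\<Sum>j\<in>J. c r j * x j) = 0" for x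
  proof -
    define z where "z i = (if i \<in> J then x i else 0)" for i
    have "(\<Sum>i\<in>\<tau>0. c r i * z i) = (\<Sum>j\<in>J. c r j * x j)" for r
    proof -
      have "(\<Sum>i\<in>\<tau>0. c r i * z i) = (\<Sum>j\<in>J. c r j * z j)"
        using tau(3)[OF \<tau>0] by (intro sum.mono_neutral_right) (auto simp: z_def J_def)
      then show ?thesis
        by (simp add: z_def cong: sum.cong_simp)
    qed
    then have "\<forall>r<d. (\<Sum>i\<in>\<tau>0. c r i * z i) = 0"
      using x by metis
    moreover have "z j0 = 0"
      by (simp add: z_def J_def)
    ultimately have "\<forall>i\<in>\<tau>0. z i = 0"
      by (rule spans_positively_kernelD[OF c[OF \<tau>0] _ j0])
    then show ?thesis
      unfolding z_def J_def by (metis DiffD1)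
  qed
  define ker where "ker x \<longleftrightarrow> (\<forall>r<d. (\<Sum>i\<in>{1..n}. c r i * x i) = 0)" for x
  have sum_BJ: "(\<Sum>i\<in>{1..n}. c r i * x i) = (\<Sum>i\<in>B. c r i * x i) + (\<Sum>j\<in>J. c r j * x j)" for r x
    using sum.union_disjoint[OF BJ(3,4,2), of "\<lambda>i. c r i * x i"] BJ(1) by simp
  \<comment> \<open>The coordinates in \<open>J\<close> solve a square system with independent
    columns, so those in \<open>B\<close> are free. This gives the basis \<open>V\<close> of the
    kernel dual to the coordinates in \<open>B\<close>.\<close>
  have "\<exists>x. ker x \<and> (\<forall>i\<in>B. x i = (if i = k then 1 else 0))" for k
  proof -
    define w where "w i = (if i = k then 1 else 0 :: real)" for i
    obtain x where x: "\<forall>r<d. (\<Sum>j\<in>J. c r j * x j) = - (\<Sum>i\<in>B. c r i * w i)"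
      using square_system_solvable[OF BJ(4,5) inj, where y = "\<lambda>r. - (\<Sum>i\<in>B. c r i * w i)"] by auto
    define z where "z i = (if i \<in> J then x i else w i)" for i
    have "(\<Sum>i\<in>B. c r i * z i) = (\<Sum>i\<in>B. c r i * w i)" for r
      using BJ(2) by (intro sum.cong) (auto simp: z_def)
    moreover have "(\<Sum>j\<in>J. c r j * z j) = (\<Sum>j\<in>J. c r j * x j)" for r
      by (intro sum.cong) (auto simp: z_def)
    ultimately have "ker z"
      using x unfolding ker_def sum_BJ by simp
    moreover have "\<forall>i\<in>B. z i = w i"
      using BJ(2) by (auto simp: z_def)
    ultimately show ?thesis
      by (auto simp: w_def)
  qed
  then obtain V where V: "\<And>k. ker (V k)" "\<And>k i. i \<in> B \<Longrightarrow> V k i = (if i = k then 1 else 0)"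
    by metis
  have ker_sum: "ker (\<lambda>i. \<Sum>k\<in>B. w k * V k i)" for w
    unfolding ker_def
  proof (intro allI impI)
    fix r assume "r < d"
    have "(\<Sum>i\<in>{1..n}. c r i * (\<Sum>k\<in>B. w k * V k i)) = (\<Sum>k\<in>B. w k * (\<Sum>i\<in>{1..n}. c r i * V k i))"
      unfolding sum_distrib_left by (subst sum.swap) (simp add: algebra_simps)
    then show "(\<Sum>i\<in>{1..n}. c r i * (\<Sum>k\<in>B. w k * V k i)) = 0"
      using V(1) \<open>r < d\<close> by (simp add: ker_def)
  qed
  have ker_add: "ker (\<lambda>i. x i + t * y i)" if "ker x" "ker y" for x y t
  proof -
    have "(\<Sum>i\<in>{1..n}. c r i * (x i + t * y i))
        = (\<Sum>i\<in>{1..n}. c r i * x i) + t * (\<Sum>i\<in>{1..n}. c r i * y i)" for r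
      by (simp add: sum_distrib_left sum.distrib algebra_simps)
    then show ?thesis
      using that by (simp add: ker_def)
  qed
  have sum_V: "(\<Sum>k\<in>B. w k * V k i) = w i" if "i \<in> B" for i w
  proof -
    have "(\<Sum>k\<in>B. w k * V k i) = (\<Sum>k\<in>B. if k = i then w k else 0)"
      using that by (intro sum.cong) (auto simp: V(2))
    then show ?thesis
      using that BJ(3) by simp
  qed
  have expand: "x i = (\<Sum>k\<in>B. x k * V k i)" if "ker x" "i \<in> {1..n}" for x i
  proof (cases "i \<in> B")
    case False
    define z where "z i = x i + (- 1) * (\<Sum>k\<in>B. x k * V k i)" for i
    have "ker z"
      unfolding z_def by (rule ker_add[OF that(1) ker_sum])
    moreover have "z i = 0" if "i \<in> B" for i
      using that by (simp add: z_def sum_V)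
    ultimately have "\<forall>j\<in>J. z j = 0"
      by (intro inj) (simp add: ker_def sum_BJ del: One_nat_def)
    then show ?thesis
      using False that BJ(1) by (auto simp: z_def)
  qed (simp add: sum_V)
  have ker_tau: "ker (\<lambda>i. if i \<in> \<tau> then y i else 0) \<longleftrightarrow> (\<forall>r<d. (\<Sum>i\<in>\<tau>. c r i * y i) = 0)"
    if "\<tau> \<in> \<Gamma>" for \<tau> y
  proof -
    have "(\<Sum>i\<in>{1..n}. c r i * (if i \<in> \<tau> then y i else 0)) = (\<Sum>i\<in>\<tau>. c r i * y i)" for r
      using tau[OF that] by (intro sum.mono_neutral_cong_right) auto
    then show ?thesis
      by (simp add: ker_def)
  qed
  \<comment> \<open>the vector of \<open>\<tau>0\<close>, pushed slightly in a kernel direction that is positive off \<open>\<tau>0\<close>\<close>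
  have "\<exists>g. ker g \<and> (\<forall>i\<in>{1..n}. g i > 0)"
  proof -
    obtain y0 where y0: "\<forall>i\<in>\<tau>0. y0 i > 0" "\<forall>r<d. (\<Sum>i\<in>\<tau>0. c r i * y0 i) = 0"
      using c[OF \<tau>0] unfolding spans_positively_def by blast
    define z0 where "z0 i = (if i \<in> \<tau>0 then y0 i else 0)" for i
    define v where "v i = (\<Sum>k\<in>B. 1 * V k i)" for i
    have "\<forall>\<^sub>F t in at_right 0. z0 i + t * v i > 0" if "i \<in> \<tau>0" for i
    proof -
      have "((\<lambda>t. z0 i + t * v i) \<longlongrightarrow> z0 i + 0 * v i) (at_right 0)"
        by (intro tendsto_intros)
      then show ?thesis
        using that y0(1) by (intro order_tendstoD(1)) (auto simp: z0_def)
    qed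
    then have "\<forall>\<^sub>F t in at_right 0. \<forall>i\<in>\<tau>0. z0 i + t * v i > 0"
      using tau(3)[OF \<tau>0] by (simp add: eventually_ball_finite)
    then have "\<forall>\<^sub>F t in at_right 0. (\<forall>i\<in>\<tau>0. z0 i + t * v i > 0) \<and> t > 0"
      using eventually_at_right_less eventually_conj by blast
    then obtain t where t: "\<forall>i\<in>\<tau>0. z0 i + t * v i > 0" "t > (0::real)"
      using eventually_happens trivial_limit_at_right_real by blast
    have "z0 i + t * v i > 0" if "i \<in> {1..n}" for i
    proof (cases "i \<in> \<tau>0")
      case False
      then have "i \<in> B"
        using that by (simp add: B_def)
      then show ?thesis
        using False t(2) sum_V[of i "\<lambda>_. 1"] by (simp add: z0_def v_def)
    qed (use t(1) in blast)
    moreover have "ker z0"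
      unfolding z0_def using y0(2) ker_tau[OF \<tau>0] by blast
    then have "ker (\<lambda>i. z0 i + t * v i)"
      unfolding v_def by (rule ker_add[OF _ ker_sum])
    ultimately show ?thesis
      by blast
  qed
  then obtain g where g: "ker g" "\<And>i. i \<in> {1..n} \<Longrightarrow> g i > 0"
    by blast
  \<comment> \<open>The points indexed by \<open>B\<close> may be put on any affine basis; the
    kernel then determines the positions of all the others.\<close>
  obtain b :: "'a set" where b: "\<not> affine_dependent b" "affine hull b = UNIV"
    using affine_basis_exists[of UNIV] by auto
  then have "aff_dim b = int DIM('a)"
    by (metis aff_dim_UNIV aff_dim_affine_hull)
  then have "finite b" "card b = card B"
    using b(1) affine_independent_iff_card[of b] cardB by auto
  then obtain q where q: "bij_betw q B b"
    using BJ(3) finite_same_card_bij by metis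
  have dimq: "aff_dim (q ` B) = int DIM('a)" "aff_dim (q ` B) = int (card B) - 1"
    using q \<open>aff_dim b = int DIM('a)\<close> cardB by (auto simp: bij_betw_def)
  \<comment> \<open>\<open>g\<close> dehomogenises: the kernel consists of the vectors \<open>\<lambda>i. g i * L (p i)\<close> with \<open>L\<close> affine\<close>
  define p where "p i = (\<Sum>k\<in>B. (g k * V k i / g i) *\<^sub>R q k)" for i
  \<comment> \<open>As \<open>g\<close> is itself in the kernel, the weights
    \<open>g k * V k i / g i\<close> sum to 1. So \<open>p i\<close> is an affine combination of the
    points \<open>q k\<close>, and affine functions respect it.\<close>
  have pL: "g i * (inner u (p i) + v) = (\<Sum>k\<in>B. (g k * (inner u (q k) + v)) * V k i)"
    if "i \<in> {1..n}" for i u v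
  proof -
    have "g i * inner u (p i) = (\<Sum>k\<in>B. g k * inner u (q k) * V k i)"
      using g(2)[OF that] by (simp add: p_def inner_sum_right sum_distrib_left algebra_simps)
    moreover have "g i * v = (\<Sum>k\<in>B. g k * v * V k i)"
      unfolding expand[OF g(1) that] by (simp add: sum_distrib_left sum_distrib_right algebra_simps)
    ultimately show ?thesis
      by (simp add: algebra_simps sum.distrib)
  qed
  have Bsub: "k \<in> {1..n}" if "k \<in> B" for k
    using that BJ(1) by blast
  have p_eq_q: "inner u (p k) + v = inner u (q k) + v" if "k \<in> B" for k u v
    using pL[OF Bsub[OF that], of u v] g(2)[OF Bsub[OF that]] by (simp add: sum_V[OF that])
  have ker_pL: "ker (\<lambda>i. g i * (inner u (p i) + v))" for u v
  proof -
    have "(\<Sum>i\<in>{1..n}. c r i * (g i * (inner u (p i) + v)))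
        = (\<Sum>i\<in>{1..n}. c r i * (\<Sum>k\<in>B. (g k * (inner u (q k) + v)) * V k i))" for r
      by (rule sum.cong[OF refl]) (simp only: pL)
    then show ?thesis
      using ker_sum[of "\<lambda>k. g k * (inner u (q k) + v)"] by (simp add: ker_def)
  qed
  have "facet_config {1..n} p ({1..n} - \<tau>)" if "\<tau> \<in> \<Gamma>" for \<tau>
  proof -
    let ?\<sigma> = "{1..n} - \<tau>"
    obtain y where y: "\<forall>i\<in>\<tau>. y i > 0" "\<forall>r<d. (\<Sum>i\<in>\<tau>. c r i * y i) = 0"
      using c[OF \<open>\<tau> \<in> \<Gamma>\<close>] unfolding spans_positively_def by blast
    define z where "z i = (if i \<in> \<tau> then y i else 0)" for i
    have "ker z"
      unfolding z_def using y(2) ker_tau[OF \<open>\<tau> \<in> \<Gamma>\<close>] by blast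
    obtain u v where uv: "\<forall>k\<in>B. inner u (q k) + v = z k / g k"
      using affine_interpolation_indexed[OF BJ(3) dimq(2), of "\<lambda>k. z k / g k"] by blast
    have zL: "z i = g i * (inner u (p i) + v)" if "i \<in> {1..n}" for i
    proof -
      have "z i = (\<Sum>k\<in>B. z k * V k i)"
        by (rule expand[OF \<open>ker z\<close> that])
      also have "\<dots> = (\<Sum>k\<in>B. (g k * (inner u (q k) + v)) * V k i)"
      proof (rule sum.cong[OF refl])
        fix k assume k: "k \<in> B"
        then have "z k = g k * (inner u (q k) + v)"
          using uv g(2)[OF Bsub[OF k]] by simp
        then show "z k * V k i = g k * (inner u (q k) + v) * V k i"
          by simp
      qed
      finally show ?thesis
        using pL[OF that] by simp
    qed
    have "inner (- u) (p i) = v" if "i \<in> ?\<sigma>" for i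
      using zL[of i] that g(2)[of i] by (auto simp: z_def)
    moreover have "inner (- u) (p i) < v" if "i \<in> {1..n} - ?\<sigma>" for i
    proof -
      have "i \<in> {1..n}" "i \<in> \<tau>"
        using that by auto
      then have "z i > 0"
        using y(1) by (simp add: z_def)
      then have "g i * (inner u (p i) + v) > 0"
        using zL[OF \<open>i \<in> {1..n}\<close>] by metis
      then show ?thesis
        using g(2)[OF \<open>i \<in> {1..n}\<close>] by (simp add: zero_less_mult_iff)
    qed
    moreover have "aff_dim (p ` ?\<sigma>) = int DIM('a) - 1"
    proof -
      have "card ?\<sigma> = DIM('a)"
        using tau[OF \<open>\<tau> \<in> \<Gamma>\<close>] dim by (simp add: card_Diff_subset)
      then have "aff_dim (p ` ?\<sigma>) \<le> int DIM('a) - 1"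
        using aff_dim_le_card[of "p ` ?\<sigma>"] card_image_le[of ?\<sigma> p] by simp
      \<comment> \<open>Otherwise some hyperplane contains the points off \<open>\<tau>\<close> and
        also \<open>p j\<close>. Its equation multiplied by \<open>g\<close> is a kernel vector
        supported in \<open>\<tau>\<close> and zero at \<open>j\<close>, hence zero on the affine
        basis too.\<close>
      moreover have "\<not> aff_dim (p ` ?\<sigma>) < int DIM('a) - 1"
      proof
        assume less: "aff_dim (p ` ?\<sigma>) < int DIM('a) - 1"
        obtain j where j: "j \<in> \<tau>"
          using tau(2)[OF \<open>\<tau> \<in> \<Gamma>\<close>] by fastforce
        have "aff_dim (insert (p j) (p ` ?\<sigma>)) < int DIM('a)"
          using less by (simp add: aff_dim_insert)
        then obtain u' v' where uv': "u' \<noteq> 0" "insert (p j) (p ` ?\<sigma>) \<subseteq> {x. inner u' x = v'}"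
          by (rule aff_lowdim_subset_hyperplane)
        define x where "x i = g i * (inner u' (p i) + (- v'))" for i
        have x0: "x i = 0" if "i \<in> insert j ?\<sigma>" for i
        proof -
          have "p i \<in> insert (p j) (p ` ?\<sigma>)"
            using that by blast
          then have "inner u' (p i) = v'"
            using uv'(2) by blast
          then show ?thesis
            by (simp add: x_def)
        qed
        have "ker x"
          unfolding x_def by (rule ker_pL)
        moreover have "(\<Sum>i\<in>{1..n}. c r i * x i) = (\<Sum>i\<in>\<tau>. c r i * x i)" for r
          using tau[OF \<open>\<tau> \<in> \<Gamma>\<close>] x0 by (intro sum.mono_neutral_right) auto
        ultimately have "\<forall>r<d. (\<Sum>i\<in>\<tau>. c r i * x i) = 0"
          by (simp add: ker_def)
        then have "\<forall>i\<in>\<tau>. x i = 0"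
          by (rule spans_positively_kernelD[OF c[OF \<open>\<tau> \<in> \<Gamma>\<close>] _ j x0]) simp
        then have x_all: "x i = 0" if "i \<in> {1..n}" for i
          using that x0 by blast
        have "inner u' s + (- v') = 0" if s: "s \<in> q ` B" for s
        proof -
          obtain k where k: "k \<in> B" "s = q k"
            using s by blast
          have "g k * (inner u' (p k) + (- v')) = 0"
            using x_all[OF Bsub[OF k(1)]] by (simp add: x_def)
          then show ?thesis
            using p_eq_q[OF k(1), of u' "- v'"] g(2)[OF Bsub[OF k(1)]] k(2) by simp
        qed
        then show False
          using affine_functional_eq_0[OF dimq(1)] uv'(1) by blast
      qed
      ultimately show ?thesis
        by linarith
    qed
    ultimately show ?thesis
      unfolding facet_config_def by blast
  qed
  then show ?thesis
    by blast
qed auto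

section \<open>Perturbation to general position\<close>

text \<open>If \<open>j\<close> is not in \<open>\<sigma>\<close>, only a strict inequality has to
  persist. If it is, the hyperplane has to follow the point: it is tilted about the remaining points
  of \<open>\<sigma>\<close>, and the tilt tends to zero as \<open>y\<close> tends to
  \<open>p j\<close>.\<close>

lemma facet_config_eventually_upd:
  fixes p :: "'i \<Rightarrow> 'a::euclidean_space"
  assumes fc: "facet_config I p \<sigma>" and I: "finite I" "\<sigma> \<subseteq> I" "card \<sigma> = DIM('a)" and j: "j \<in> I"
  shows "\<forall>\<^sub>F y in nhds (p j). facet_config I (p(j := y)) \<sigma>"
proof -
  have dim: "aff_dim (p ` \<sigma>) = int DIM('a) - 1"
    using fc by (simp add: facet_config_def)
  obtain a b where ab: "\<forall>i\<in>\<sigma>. inner a (p i) = b" "\<forall>i\<in>I - \<sigma>. inner a (p i) < b"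
    using fc unfolding facet_config_def by blast
  have tendsto: "((\<lambda>y. inner u y) \<longlongrightarrow> inner u (p j)) (nhds (p j))" for u
    by (intro tendsto_intros filterlim_ident)
  show ?thesis
  proof (cases "j \<in> \<sigma>")
    case False
    have "\<forall>\<^sub>F y in nhds (p j). inner a y < b"
      using ab(2) j False by (intro order_tendstoD(2)[OF tendsto]) auto
    then show ?thesis
    proof eventually_elim
      case (elim y)
      have "(p(j := y)) ` \<sigma> = p ` \<sigma>"
        using False by auto
      then show ?case
        unfolding facet_config_def using dim ab elim False by (auto intro!: exI[of _ a] exI[of _ b])
    qed
  next
    case True
    have "finite \<sigma>"
      using I finite_subset by blast
    moreover have "aff_dim (p ` \<sigma>) = int (card \<sigma>) - 1"
      using dim I(3) by simp
    ultimately obtain c e where ce: "\<forall>i\<in>\<sigma>. inner c (p i) + e = (if i = j then 1 else 0)"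
      using affine_interpolation_indexed[of \<sigma> p "\<lambda>i. if i = j then 1 else 0"] by blast
    \<comment> \<open>The function given by \<open>c\<close> and \<open>e\<close> is 1 at
      \<open>p j\<close> and 0 at the other points of \<open>\<sigma>\<close>. Subtracting
      \<open>s y\<close> times it from the old equation makes the equation hold at \<open>y\<close>
      and keeps it at those other points.\<close>
    define s where "s y = (inner a y - b) / (inner c y + e)" for y
    have ce_j: "inner c (p j) + e = 1" and ab_j: "inner a (p j) = b"
      using ce ab True by auto
    have "((\<lambda>y. inner c y + e) \<longlongrightarrow> 1) (nhds (p j))"
      unfolding ce_j[symmetric] by (intro tendsto_intros tendsto)
    moreover have "((\<lambda>y. inner a y - b) \<longlongrightarrow> b - b) (nhds (p j))"
      using tendsto_diff[OF tendsto[of a] tendsto_const[of b]] ab_j by simp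
    ultimately have s: "(s \<longlongrightarrow> 0) (nhds (p j))"
      and pos: "\<forall>\<^sub>F y in nhds (p j). inner c y + e > 0"
      unfolding s_def using tendsto_divide[of "\<lambda>y. inner a y - b" 0 _ "\<lambda>y. inner c y + e" 1]
      by (auto dest: order_tendstoD(1)[of _ _ _ 0])
    have "\<forall>\<^sub>F y in nhds (p j). inner a (p i) - s y * (inner c (p i) + e) < b" if "i \<in> I - \<sigma>" for i
    proof -
      have "((\<lambda>y. inner a (p i) - s y * (inner c (p i) + e)) \<longlongrightarrow> inner a (p i) - 0 * (inner c (p i) + e))
        (nhds (p j))"
        by (intro tendsto_intros s)
      then show ?thesis
        using that ab(2) by (intro order_tendstoD(2)) auto
    qed
    then have "\<forall>\<^sub>F y in nhds (p j). \<forall>i\<in>I - \<sigma>. inner a (p i) - s y * (inner c (p i) + e) < b"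
      using I(1) by (simp add: eventually_ball_finite)
    then show ?thesis
      using pos
    proof eventually_elim
      case (elim y)
      \<comment> \<open>Neither \<open>p j\<close> nor \<open>y\<close> is in the affine hull of the
        other points of \<open>\<sigma>\<close>, so replacing one by the other keeps the
        dimension.\<close>
      have hull: "affine hull (p ` (\<sigma> - {j})) \<subseteq> {x. inner c x = - e}"
        using ce by (intro hull_minimal affine_hyperplane) (auto simp: eq_neg_iff_add_eq_0)
      then have "p j \<notin> affine hull (p ` (\<sigma> - {j}))" "y \<notin> affine hull (p ` (\<sigma> - {j}))"
        using ce_j elim(2) by auto
      moreover have "p ` \<sigma> = insert (p j) (p ` (\<sigma> - {j}))"
        "(p(j := y)) ` \<sigma> = insert y (p ` (\<sigma> - {j}))"
        using True by auto
      ultimately have "aff_dim ((p(j := y)) ` \<sigma>) = int DIM('a) - 1"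
        using dim by (simp add: aff_dim_insert)
      moreover have "inner (a - s y *\<^sub>R c) ((p(j := y)) i) = b + s y * e" if "i \<in> \<sigma>" for i
      proof (cases "i = j")
        case True
        have "inner a y - b = s y * (inner c y + e)"
          using elim(2) by (simp add: s_def)
        then show ?thesis
          using True by (simp add: inner_diff_left algebra_simps)
      next
        case False
        then have "inner c (p i) = - e"
          using ce that by (simp add: eq_neg_iff_add_eq_0)
        then show ?thesis
          using False ab(1) that by (simp add: inner_diff_left algebra_simps)
      qed
      moreover have "inner (a - s y *\<^sub>R c) ((p(j := y)) i) < b + s y * e" if "i \<in> I - \<sigma>" for i
        using bspec[OF elim(1) that] that True by (auto simp: inner_diff_left algebra_simps)
      ultimately show ?case
        unfolding facet_config_def by blast
    qed
  qed
qed

text \<open>The affine hull of at most \<open>DIM('a)\<close> points is closed with empty interior.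
  This passes to finite unions, so no neighbourhood of \<open>x\<close> is covered.\<close>

lemma eventually_nhds_avoid_affine_hulls:
  fixes x :: "'a::euclidean_space"
  assumes ev: "eventually P (nhds x)" and L: "finite \<L>" "\<And>L. L \<in> \<L> \<Longrightarrow> finite L \<and> card L \<le> DIM('a)"
  shows "\<exists>y. P y \<and> (\<forall>L\<in>\<L>. y \<notin> affine hull L)"
proof -
  obtain U where U: "open U" "x \<in> U" "\<forall>y\<in>U. P y"
    using ev by (auto simp: eventually_nhds)
  have "interior (\<Union>L\<in>\<L>. affine hull L) = {} \<and> closed (\<Union>L\<in>\<L>. affine hull L)"
    using L
  proof (induction \<L> rule: finite_induct)
    case (insert L \<L>)
    then show ?case
      using closed_affine_hull[of L] by (simp add: interior_closed_Un_empty_interior empty_interior_affine_hull closed_Un)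
  qed simp
  then have "\<not> U \<subseteq> (\<Union>L\<in>\<L>. affine hull L)"
    using U by (metis empty_iff interior_maximal subset_iff)
  then show ?thesis
    using U(3) by blast
qed

text \<open>The dimension of the image is compared with the number of indices, so the condition
  includes injectivity, by the two-element sets. \<open>DIM('a) + 1\<close> is the largest possible
  size of an affinely independent set.\<close>

definition general_position :: "'i set \<Rightarrow> ('i \<Rightarrow> 'a::euclidean_space) \<Rightarrow> bool" where
  "general_position I p \<longleftrightarrow>
     (\<forall>J\<subseteq>I. card J \<le> Suc DIM('a) \<longrightarrow> aff_dim (p ` J) = int (card J) - 1)"

text \<open>Points are moved one at a time. The next point stays in a neighbourhood where all facets
  persist and avoids the finitely many affine hulls of at most \<open>DIM('a)\<close> points that
  are already in general position.\<close>

lemma facet_config_perturb: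
  fixes p :: "'i \<Rightarrow> 'a::euclidean_space"
  assumes I: "finite I"
    and S: "finite S" "\<And>\<sigma>. \<sigma> \<in> S \<Longrightarrow> \<sigma> \<subseteq> I \<and> card \<sigma> = DIM('a) \<and> facet_config I p \<sigma>"
  shows "\<exists>q :: 'i \<Rightarrow> 'a. (\<forall>\<sigma>\<in>S. facet_config I q \<sigma>) \<and> general_position I q"
proof -
  have "\<exists>q :: 'i \<Rightarrow> 'a. (\<forall>\<sigma>\<in>S. facet_config I q \<sigma>) \<and> general_position K q" if "K \<subseteq> I" for K
    using finite_subset[OF that I] that
  proof (induction K rule: finite_induct)
    case empty
    then show ?case
      using S(2) by (auto simp: general_position_def)
  next
    case (insert j K)
    then obtain q :: "'i \<Rightarrow> 'a" where q: "\<forall>\<sigma>\<in>S. facet_config I q \<sigma>" "general_position K q"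
      by auto
    let ?\<L> = "(\<lambda>J. q ` J) ` {J. J \<subseteq> K \<and> card J \<le> DIM('a)}"
    have "\<forall>\<^sub>F y in nhds (q j). \<forall>\<sigma>\<in>S. facet_config I (q(j := y)) \<sigma>"
      using S q(1) I insert.prems by (simp add: eventually_ball_finite facet_config_eventually_upd)
    moreover have "finite ?\<L>"
      using insert.hyps(1) by simp
    moreover have "finite L \<and> card L \<le> DIM('a)" if L: "L \<in> ?\<L>" for L
    proof -
      obtain J where J: "J \<subseteq> K" "card J \<le> DIM('a)" "L = q ` J"
        using L by blast
      then have "finite J"
        using insert.hyps(1) finite_subset by blast
      then show ?thesis
        using J card_image_le[of J q] by simp
    qed
    ultimately have "\<exists>y. (\<forall>\<sigma>\<in>S. facet_config I (q(j := y)) \<sigma>) \<and> (\<forall>L\<in>?\<L>. y \<notin> affine hull L)"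
      by (rule eventually_nhds_avoid_affine_hulls)
    then obtain y where y: "\<forall>\<sigma>\<in>S. facet_config I (q(j := y)) \<sigma>"
      "\<And>J. J \<subseteq> K \<Longrightarrow> card J \<le> DIM('a) \<Longrightarrow> y \<notin> affine hull (q ` J)"
      by auto
    have "general_position (insert j K) (q(j := y))"
      unfolding general_position_def
    proof (intro allI impI)
      fix J assume J: "J \<subseteq> insert j K" "card J \<le> Suc DIM('a)"
      show "aff_dim ((q(j := y)) ` J) = int (card J) - 1"
      proof (cases "j \<in> J")
        case True
        have fin: "finite (J - {j})"
          using J(1) insert.hyps(1) by (metis finite_Diff finite_insert finite_subset)
        have J': "J - {j} \<subseteq> K" "card J = Suc (card (J - {j}))"
          using J(1) True fin card_Suc_Diff1[of J j] by auto
        have "(q(j := y)) ` J = insert y (q ` (J - {j}))"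
          using True by auto
        then show ?thesis
          using y(2)[OF J'(1)] J J' q(2) by (simp add: aff_dim_insert general_position_def)
      next
        case False
        then have "J \<subseteq> K" "(q(j := y)) ` J = q ` J"
          using J(1) by auto
        then show ?thesis
          using q(2) J(2) by (simp add: general_position_def)
      qed
    qed
    then show ?case
      using y(1) by blast
  qed
  then show ?thesis
    by blast
qed

section \<open>Convex hulls of points in general position\<close>

lemma vertices_of_convex_hull:
  "\<not> affine_dependent S \<Longrightarrow> vertices_of (convex hull S) = S"
  by (simp add: vertices_of_def extreme_point_of_convex_hull_affine_independent)

context
  fixes I :: "'i set" and p :: "'i \<Rightarrow> 'a::euclidean_space"
  assumes I: "finite I" "Suc DIM('a) \<le> card I" and gp: "general_position I p"
begin

lemma general_position_aff_dim:
  "J \<subseteq> I \<Longrightarrow> card J \<le> Suc DIM('a) \<Longrightarrow> aff_dim (p ` J) = int (card J) - 1"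
  using gp by (simp add: general_position_def)

lemma general_position_inj: "inj_on p I"
proof (rule inj_onI)
  fix i j assume ij: "i \<in> I" "j \<in> I" "p i = p j"
  have "1 \<le> DIM('a)"
    using DIM_positive[where 'a = 'a] by linarith
  then have "card {i, j} \<le> Suc DIM('a)"
    by (cases "i = j") simp_all
  then have "aff_dim (p ` {i, j}) = int (card {i, j}) - 1"
    using ij by (intro general_position_aff_dim) auto
  then show "i = j"
    using ij(3) by (cases "i = j") simp_all
qed

lemma general_position_aff_dim_hull: "aff_dim (convex hull (p ` I)) = int DIM('a)"
proof -
  obtain J where "J \<subseteq> I" "card J = Suc DIM('a)"
    using I by (meson obtain_subset_with_card_n)
  then have "int DIM('a) \<le> aff_dim (p ` I)"
    using general_position_aff_dim[of J] aff_dim_subset[of "p ` J" "p ` I"] by auto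
  then show ?thesis
    using aff_dim_le_DIM[of "p ` I"] by (simp add: aff_dim_convex_hull)
qed

text \<open>A facet is the hull of some of the points; \<open>DIM('a) + 1\<close> of them would span
  the whole space, and fewer than \<open>DIM('a)\<close> cannot span a facet.\<close>

lemma general_position_facet:
  assumes "G facet_of convex hull (p ` I)"
  obtains \<sigma> where "\<sigma> \<subseteq> I" "card \<sigma> = DIM('a)" "G = convex hull (p ` \<sigma>)" "\<not> affine_dependent (p ` \<sigma>)"
proof -
  have dimG: "aff_dim G = int DIM('a) - 1"
    using assms general_position_aff_dim_hull by (simp add: facet_of_def)
  obtain S where S: "S \<subseteq> p ` I" "G = convex hull S"
    using face_of_convex_hull_subset[of "p ` I" G] assms I(1)
    by (metis facet_of_imp_face_of finite_imageI finite_imp_compact)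
  then obtain \<sigma> where \<sigma>: "\<sigma> \<subseteq> I" "S = p ` \<sigma>"
    by (meson subset_imageE)
  have fin: "finite \<sigma>"
    using \<sigma>(1) I(1) finite_subset by blast
  have "card \<sigma> \<le> DIM('a)"
  proof (rule ccontr)
    assume "\<not> card \<sigma> \<le> DIM('a)"
    then obtain J where "J \<subseteq> \<sigma>" "card J = Suc DIM('a)"
      by (meson not_less_eq_eq obtain_subset_with_card_n)
    then have "aff_dim (p ` J) = int DIM('a)"
      using general_position_aff_dim[of J] \<sigma>(1) by auto
    moreover have "aff_dim (p ` J) \<le> aff_dim (p ` \<sigma>)"
      using \<open>J \<subseteq> \<sigma>\<close> by (intro aff_dim_subset image_mono)
    ultimately show False
      using dimG S(2) \<sigma>(2) by (simp add: aff_dim_convex_hull)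
  qed
  moreover from this have "aff_dim (p ` \<sigma>) = int (card \<sigma>) - 1"
    using general_position_aff_dim[OF \<sigma>(1)] by simp
  moreover from this have "card \<sigma> = DIM('a)"
    using dimG S(2) \<sigma>(2) by (simp add: aff_dim_convex_hull)
  ultimately show thesis
    using that[OF \<sigma>(1)] S(2) \<sigma>(2) aff_dim_image_eq_card_imp_independent(2)[OF fin] by blast
qed

lemma general_position_simplicial_polytope: "simplicial_polytope (convex hull (p ` I))"
  unfolding simplicial_polytope_def
proof (intro conjI allI impI)
  show "polytope (convex hull (p ` I))"
    using I(1) by (auto simp: polytope_def)
next
  fix G assume "G facet_of convex hull (p ` I)"
  then obtain \<sigma> where \<sigma>: "\<sigma> \<subseteq> I" "card \<sigma> = DIM('a)" "G = convex hull (p ` \<sigma>)" "\<not> affine_dependent (p ` \<sigma>)"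
    by (rule general_position_facet)
  then show "\<exists>k. k simplex G"
    unfolding simplex_def
    by (intro exI[of _ "int (card (p ` \<sigma>)) - 1"] exI[of _ "p ` \<sigma>"]) auto
qed

text \<open>The supporting hyperplane cuts out a face, which is the hull of those points of the
  configuration that it contains, and the strict inequalities leave only the points of
  \<open>\<sigma>\<close>.\<close>

lemma facet_config_imp_facet:
  assumes fc: "facet_config I p \<sigma>" and "\<sigma> \<subseteq> I" "card \<sigma> = DIM('a)"
  shows "convex hull (p ` \<sigma>) facet_of convex hull (p ` I)" "vertices_of (convex hull (p ` \<sigma>)) = p ` \<sigma>"
proof -
  let ?P = "convex hull (p ` I)"
  obtain a b where ab: "\<forall>i\<in>\<sigma>. inner a (p i) = b" "\<forall>i\<in>I - \<sigma>. inner a (p i) < b"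
    and dim: "aff_dim (p ` \<sigma>) = int DIM('a) - 1"
    using fc unfolding facet_config_def by blast
  have "inner a x \<le> b" if "x \<in> p ` I" for x
    using that ab by force
  then have "?P \<subseteq> {x. inner a x \<le> b}"
    by (intro hull_minimal convex_halfspace_le) auto
  then have face: "?P \<inter> {x. inner a x = b} face_of ?P"
    by (intro face_of_Int_supporting_hyperplane_le) auto
  then obtain S where S: "S \<subseteq> p ` I" "?P \<inter> {x. inner a x = b} = convex hull S"
    using face_of_convex_hull_subset I(1) by (metis finite_imageI finite_imp_compact)
  have "S \<subseteq> {x. inner a x = b}"
    using S(2) hull_subset[of S convex] by blast
  then have "S \<subseteq> p ` \<sigma>"
    using S(1) ab(2) by fastforce
  moreover have "p ` \<sigma> \<subseteq> ?P \<inter> {x. inner a x = b}"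
    using ab(1) \<open>\<sigma> \<subseteq> I\<close> by (auto intro: hull_inc)
  then have "convex hull (p ` \<sigma>) \<subseteq> ?P \<inter> {x. inner a x = b}"
    by (intro hull_minimal) (simp_all add: convex_Int convex_hyperplane)
  ultimately have "convex hull (p ` \<sigma>) = ?P \<inter> {x. inner a x = b}"
    using S(2) hull_mono[of S "p ` \<sigma>" convex] by blast
  then show "convex hull (p ` \<sigma>) facet_of ?P"
    using face dim general_position_aff_dim_hull assms(3) DIM_positive[where 'a = 'a]
    by (auto simp: facet_of_def simp flip: aff_dim_convex_hull[of "p ` \<sigma>"])
  show "vertices_of (convex hull (p ` \<sigma>)) = p ` \<sigma>"
    using aff_dim_image_eq_card_imp_independent(2)[of \<sigma> p] dim assms I(1) finite_subset
    by (intro vertices_of_convex_hull) auto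
qed

end

section \<open>Schlegel diagrams\<close>

text \<open>A projective map with positive denominator maps segments onto segments: going forward
  the weights are multiplied by the denominators of the end points, going back they are divided by
  them, and each time they are normalised.\<close>

lemma projective_convex_hull:
  fixes S :: "'a::euclidean_space set" and u c :: 'a
  assumes pos: "\<And>x. x \<in> convex hull S \<Longrightarrow> 0 < inner a x + b"
  defines "\<rho> \<equiv> \<lambda>x. (1 / (inner a x + b)) *\<^sub>R (x - u) + c"
  shows "\<rho> ` (convex hull S) = convex hull (\<rho> ` S)"
proof
  define k where "k x = inner a x + b" for x
  have k_affine: "k (\<alpha> *\<^sub>R x + \<beta> *\<^sub>R y) = \<alpha> * k x + \<beta> * k y" if "\<alpha> + \<beta> = 1" for \<alpha> \<beta> x y
  proof -
    have "b = (\<alpha> + \<beta>) * b"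
      using that by simp
    then show ?thesis
      by (simp add: k_def inner_add_right algebra_simps)
  qed
  have rho: "k x *\<^sub>R \<rho> x = (x - u) + k x *\<^sub>R c" if "k x > 0" for x
    using that by (simp add: \<rho>_def k_def algebra_simps)
  have rho_eqI: "\<rho> x = y" if "k x > 0" "k x *\<^sub>R y = (x - u) + k x *\<^sub>R c" for x y
    using rho[OF that(1)] that by (metis less_irrefl scaleR_left_imp_eq)
  have "convex {x. k x > 0 \<and> \<rho> x \<in> convex hull (\<rho> ` S)}"
  proof (rule convexI)
    fix x y and \<alpha> \<beta> :: real
    assume x: "x \<in> {x. k x > 0 \<and> \<rho> x \<in> convex hull (\<rho> ` S)}"
      and y: "y \<in> {x. k x > 0 \<and> \<rho> x \<in> convex hull (\<rho> ` S)}"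
      and \<alpha>\<beta>: "0 \<le> \<alpha>" "0 \<le> \<beta>" "\<alpha> + \<beta> = 1"
    let ?z = "\<alpha> *\<^sub>R x + \<beta> *\<^sub>R y"
    have "\<alpha> * k x + \<beta> * k y > 0"
    proof (cases "\<alpha> = 0")
      case False
      then show ?thesis
        using x y \<alpha>\<beta> by (intro add_pos_nonneg) auto
    qed (use y \<alpha>\<beta> in simp)
    then have kz: "k ?z = \<alpha> * k x + \<beta> * k y" "k ?z > 0"
      using k_affine[OF \<alpha>\<beta>(3)] by simp_all
    have "\<rho> ?z = (\<alpha> * k x / k ?z) *\<^sub>R \<rho> x + (\<beta> * k y / k ?z) *\<^sub>R \<rho> y"
    proof (rule rho_eqI[OF kz(2)])
      have "k ?z *\<^sub>R ((\<alpha> * k x / k ?z) *\<^sub>R \<rho> x + (\<beta> * k y / k ?z) *\<^sub>R \<rho> y)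
          = \<alpha> *\<^sub>R (k x *\<^sub>R \<rho> x) + \<beta> *\<^sub>R (k y *\<^sub>R \<rho> y)"
        using kz(2) by (simp add: scaleR_add_right)
      also have "\<dots> = ?z - (\<alpha> + \<beta>) *\<^sub>R u + k ?z *\<^sub>R c"
        using x y by (simp only: rho mem_Collect_eq kz(1)) (simp add: algebra_simps)
      finally show "k ?z *\<^sub>R ((\<alpha> * k x / k ?z) *\<^sub>R \<rho> x + (\<beta> * k y / k ?z) *\<^sub>R \<rho> y) = (?z - u) + k ?z *\<^sub>R c"
        using \<alpha>\<beta>(3) by simp
    qed
    moreover have "\<alpha> * k x / k ?z + \<beta> * k y / k ?z = 1"
      using kz by (metis add_divide_distrib divide_self less_irrefl)
    ultimately have "\<rho> ?z \<in> convex hull (\<rho> ` S)"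
      using x y kz(2) \<alpha>\<beta> by (auto intro!: convexD[OF convex_convex_hull])
    then show "?z \<in> {x. k x > 0 \<and> \<rho> x \<in> convex hull (\<rho> ` S)}"
      using kz(2) by simp
  qed
  moreover have "S \<subseteq> {x. k x > 0 \<and> \<rho> x \<in> convex hull (\<rho> ` S)}"
    using pos by (auto simp: k_def hull_inc)
  ultimately show "\<rho> ` (convex hull S) \<subseteq> convex hull (\<rho> ` S)"
    using hull_minimal[of S _ convex] by blast
  show "convex hull (\<rho> ` S) \<subseteq> \<rho> ` (convex hull S)"
  proof (rule hull_minimal)
    show "\<rho> ` S \<subseteq> \<rho> ` (convex hull S)"
      by (intro image_mono hull_subset)
    show "convex (\<rho> ` (convex hull S))"
    proof (rule convexI)
      fix x' y' and \<alpha> \<beta> :: real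
      assume x': "x' \<in> \<rho> ` (convex hull S)" and y': "y' \<in> \<rho> ` (convex hull S)"
        and \<alpha>\<beta>: "0 \<le> \<alpha>" "0 \<le> \<beta>" "\<alpha> + \<beta> = 1"
      obtain x y where xy: "x \<in> convex hull S" "y \<in> convex hull S" "x' = \<rho> x" "y' = \<rho> y"
        using x' y' by blast
      have pos': "k x > 0" "k y > 0"
        using pos xy by (auto simp: k_def)
      \<comment> \<open>The normalising factor of the divided weights; the denominator at the
        preimage \<open>z\<close> comes out as \<open>1 / w\<close>.\<close>
      define w where "w = \<alpha> / k x + \<beta> / k y"
      have "w > 0"
        using \<alpha>\<beta> pos' unfolding w_def
        by (smt (verit) divide_nonneg_pos divide_pos_pos)
      define z where "z = (\<alpha> / k x / w) *\<^sub>R x + (\<beta> / k y / w) *\<^sub>R y"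
      have sum1: "\<alpha> / k x / w + \<beta> / k y / w = 1"
        using \<open>w > 0\<close> by (simp only: add_divide_distrib[symmetric] w_def[symmetric]) simp
      have "z \<in> convex hull S"
        using xy \<alpha>\<beta> pos' \<open>w > 0\<close> sum1 unfolding z_def
        by (intro convexD[OF convex_convex_hull]) auto
      have kz: "k z = 1 / w"
        using k_affine[OF sum1, of x y] pos' \<alpha>\<beta>(3) by (simp add: z_def flip: add_divide_distrib)
      have "\<rho> z = \<alpha> *\<^sub>R x' + \<beta> *\<^sub>R y'"
      proof (rule rho_eqI)
        have \<rho>: "\<rho> x = (1 / k x) *\<^sub>R (x - u) + c" for x
          by (simp add: \<rho>_def k_def)
        have "\<alpha> *\<^sub>R x' + \<beta> *\<^sub>R y' = (\<alpha> / k x) *\<^sub>R x + (\<beta> / k y) *\<^sub>R y - w *\<^sub>R u + (\<alpha> + \<beta>) *\<^sub>R c"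
          by (simp only: xy \<rho>) (simp add: w_def algebra_simps)
        also have "\<dots> = w *\<^sub>R (z - u) + c"
          using \<open>w > 0\<close> \<alpha>\<beta>(3) by (simp add: z_def algebra_simps)
        finally have eq: "\<alpha> *\<^sub>R x' + \<beta> *\<^sub>R y' = w *\<^sub>R (z - u) + c" .
        show "k z *\<^sub>R (\<alpha> *\<^sub>R x' + \<beta> *\<^sub>R y') = (z - u) + k z *\<^sub>R c"
          unfolding kz eq using \<open>w > 0\<close> by (simp add: scaleR_add_right)
      qed (use \<open>w > 0\<close> kz in simp)
      then show "\<alpha> *\<^sub>R x' + \<beta> *\<^sub>R y' \<in> \<rho> ` (convex hull S)"
        using \<open>z \<in> convex hull S\<close> by force
    qed
  qed
qed

lemma affine_linear_eq:
  fixes l l' :: "'a::real_vector \<Rightarrow> real"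
  assumes "linear l" "linear l'"
  shows "affine {x. l x + c = l' x + c'}"
  unfolding affine_def
proof (intro ballI allI impI)
  fix x y and \<alpha> \<beta> :: real
  assume x: "x \<in> {x. l x + c = l' x + c'}" and y: "y \<in> {x. l x + c = l' x + c'}" and ab: "\<alpha> + \<beta> = 1"
  have eq: "l x = l' x + (c' - c)" "l y = l' y + (c' - c)"
    using x y by auto
  have "l (\<alpha> *\<^sub>R x + \<beta> *\<^sub>R y) = l' (\<alpha> *\<^sub>R x + \<beta> *\<^sub>R y) + (\<alpha> + \<beta>) * (c' - c)"
    unfolding linear_add[OF assms(1)] linear_cmul[OF assms(1)] linear_add[OF assms(2)] linear_cmul[OF assms(2)] eq
    by (simp only: real_scaleR_def distrib_left distrib_right)
  then show "\<alpha> *\<^sub>R x + \<beta> *\<^sub>R y \<in> {x. l x + c = l' x + c'}"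
    using ab by simp
qed

lemma facet_subset_imp_eq:
  fixes P :: "'a::euclidean_space set"
  assumes "F facet_of P" "G facet_of P" "F \<subseteq> G"
  shows "F = G"
proof (rule ccontr)
  assume "F \<noteq> G"
  have "F face_of G"
    using assms by (meson face_of_subset facet_of_imp_face_of facet_of_imp_subset)
  then have "aff_dim F < aff_dim G"
    using face_of_aff_dim_lt \<open>F \<noteq> G\<close> assms(2) face_of_imp_convex facet_of_imp_face_of by blast
  then show False
    using assms by (simp add: facet_of_def)
qed

text \<open>The setting of a Schlegel diagram: \<open>u\<close> is beyond \<open>F\<close> and
  beneath every other facet, and those facets, all simplices, are projected onto the screen
  \<open>F\<close>. Translating by \<open>- x0\<close> moves the screen into a linear hyperplane, as
  the definition of a regular complex asks for a subspace.\<close>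

locale point_beyond_facet =
  fixes P F :: "'a::euclidean_space set" and x0 u :: 'a and a :: "'a set \<Rightarrow> 'a" and b :: "'a set \<Rightarrow> real"
  assumes polytope: "polytope P" and full_dim: "aff_dim P = int DIM('a)"
    and F: "F facet_of P" and x0: "x0 \<in> F"
    and simplex: "\<And>G. G facet_of P \<Longrightarrow> G \<noteq> F \<Longrightarrow> \<exists>k. k simplex G"
    and a_nz: "a F \<noteq> 0"
    and valid: "\<And>G x. G facet_of P \<Longrightarrow> x \<in> P \<Longrightarrow> inner (a G) x \<le> b G"
    and facet_eq: "\<And>G. G facet_of P \<Longrightarrow> G = {x \<in> P. inner (a G) x = b G}"
    and u_F: "inner (a F) u > b F"
    and u_G: "\<And>G. G facet_of P \<Longrightarrow> G \<noteq> F \<Longrightarrow> inner (a G) u < b G"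
    and other_facet: "\<exists>G. G facet_of P \<and> G \<noteq> F"
begin

text \<open>Up to the translation by \<open>- x0\<close>, \<open>\<rho>\<close> is the central projection from \<open>u\<close> to the hyperplane of \<open>F\<close>;
  \<open>q G\<close> restricted to \<open>\<rho> ` G\<close> is the ratio by which \<open>\<rho>\<close> scales the distance to \<open>u\<close>, and the boundary
  point of \<open>P\<close> seen through a point of \<open>F\<close> lies on the facet where \<open>q\<close> is largest.\<close>

definition ell :: "'a set \<Rightarrow> 'a \<Rightarrow> real" where
  "ell G x = b G - inner (a G) x"

text \<open>The denominator of the projection, equal to \<open>1 - ell F x / ell F u\<close> and
  written here as an affine function in the form required by \<open>projective_convex_hull\<close>.
  It is at least 1 on \<open>P\<close> because \<open>u\<close> is beyond \<open>F\<close>.\<close>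

definition k :: "'a \<Rightarrow> real" where
  "k x = inner ((1 / ell F u) *\<^sub>R a F) x + (1 - b F / ell F u)"

definition \<rho> :: "'a \<Rightarrow> 'a" where
  "\<rho> x = (1 / k x) *\<^sub>R (x - u) + (u - x0)"

definition q :: "'a set \<Rightarrow> 'a \<Rightarrow> real" where
  "q G x = 1 - ell G (x + x0) / ell G u"

definition facets :: "'a set set" where
  "facets = {G. G facet_of P \<and> G \<noteq> F}"

definition height :: "'a \<Rightarrow> real" where
  "height x = Max ((\<lambda>G. q G x) ` facets)"

lemma facetsD: "G \<in> facets \<Longrightarrow> G facet_of P" "G \<in> facets \<Longrightarrow> G \<noteq> F"
  by (simp_all add: facets_def)

lemma finite_facets: "finite facets"
  unfolding facets_def using finite_polytope_facets[OF polytope] by simp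

lemma facets_nonempty: "facets \<noteq> {}"
  using other_facet by (auto simp: facets_def)

lemma ell_u: "ell F u < 0" "G \<in> facets \<Longrightarrow> ell G u > 0"
  using u_F u_G by (auto simp: ell_def facets_def)

lemma ell_P: "G facet_of P \<Longrightarrow> x \<in> P \<Longrightarrow> ell G x \<ge> 0"
  using valid by (simp add: ell_def)

lemma ell_eq_0_iff: "G facet_of P \<Longrightarrow> x \<in> P \<Longrightarrow> ell G x = 0 \<longleftrightarrow> x \<in> G"
  using eqset_imp_iff[OF facet_eq[of G], of x] by (auto simp: ell_def)

lemma ell_affine: "ell G (u + t *\<^sub>R (x - u)) = (1 - t) * ell G u + t * ell G x"
  by (simp add: ell_def inner_add_right inner_diff_right algebra_simps)

lemma k_eq: "k x = 1 - ell F x / ell F u"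
  by (simp add: k_def ell_def diff_divide_distrib)

lemma k_pos: "x \<in> P \<Longrightarrow> k x \<ge> 1"
  using ell_P[OF F, of x] ell_u(1) by (simp add: k_eq divide_nonneg_neg)

lemma subset_P: "G facet_of P \<Longrightarrow> G \<subseteq> P"
  by (rule facet_of_imp_subset)

text \<open>Walk from an interior point \<open>z\<close> of \<open>P\<close> to a point
  \<open>x\<close> outside: the frontier is crossed at some \<open>w\<close> on a facet
  \<open>G\<close>. If \<open>x\<close> satisfied all inequalities, \<open>ell G\<close> would be
  positive at \<open>z\<close> and nonnegative at \<open>x\<close>, hence nonzero at
  \<open>w\<close>.\<close>

lemma mem_P_iff: "x \<in> P \<longleftrightarrow> (\<forall>G. G facet_of P \<longrightarrow> ell G x \<ge> 0)"
proof
  assume x: "\<forall>G. G facet_of P \<longrightarrow> ell G x \<ge> 0"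
  show "x \<in> P"
  proof (rule ccontr)
    assume "x \<notin> P"
    have P: "polyhedron P" "closed P" "convex P"
      using polytope by (auto simp: polytope_imp_polyhedron polytope_imp_closed polytope_imp_convex)
    have ri: "rel_interior P = interior P"
      using full_dim by (rule interior_rel_interior)
    have "P \<noteq> {}"
      using full_dim by auto
    then obtain z where z: "z \<in> rel_interior P"
      using P(3) rel_interior_eq_empty by blast
    have "z \<in> P"
      using z rel_interior_subset by blast
    have "closed_segment z x \<inter> frontier P \<noteq> {}"
      using \<open>z \<in> P\<close> \<open>x \<notin> P\<close> by (intro connected_Int_frontier) auto
    then obtain w where w: "w \<in> closed_segment z x" "w \<in> frontier P"
      by blast
    obtain t where t: "w = (1 - t) *\<^sub>R z + t *\<^sub>R x" "0 \<le> t" "t \<le> 1"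
      using w(1) by (auto simp: in_segment)
    have "w \<in> P - rel_interior P"
      using w(2) P(2) ri by (simp add: frontier_def)
    then obtain G where G: "G facet_of P" "w \<in> G"
      using rel_boundary_of_polyhedron[OF P(1)] by blast
    have "w \<in> P"
      using \<open>w \<in> P - rel_interior P\<close> by blast
    then have "t \<noteq> 1"
      using t(1) \<open>x \<notin> P\<close> by auto
    have "z \<notin> G"
      using z rel_interior_of_polyhedron[OF P(1)] G(1) by blast
    then have "ell G z > 0"
      using ell_P[OF G(1) \<open>z \<in> P\<close>] ell_eq_0_iff[OF G(1) \<open>z \<in> P\<close>] by simp
    have "ell G w = (1 - t) * ell G z + t * ell G x"
      by (simp add: t(1) ell_def inner_add_right algebra_simps)
    moreover have "(1 - t) * ell G z > 0"
      using t(3) \<open>t \<noteq> 1\<close> \<open>ell G z > 0\<close> by simp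
    moreover have "t * ell G x \<ge> 0"
      using x G(1) t(2) by simp
    ultimately show False
      using ell_eq_0_iff[OF G(1) \<open>w \<in> P\<close>] G(2) by simp
  qed
qed (use ell_P in blast)

lemma rho_eq: "\<rho> x + x0 = u + (1 / k x) *\<^sub>R (x - u)"
  by (simp add: \<rho>_def)

lemma ell_rho: "ell G (\<rho> x + x0) = (1 - 1 / k x) * ell G u + (1 / k x) * ell G x"
  unfolding rho_eq by (rule ell_affine)

lemma ell_F_rho: "x \<in> P \<Longrightarrow> ell F (\<rho> x + x0) = 0"
proof -
  assume "x \<in> P"
  have "k x * ell F u = ell F u - ell F x"
    using ell_u(1) by (simp add: k_eq field_simps)
  moreover have "k x * ell F (\<rho> x + x0) = (k x - 1) * ell F u + ell F x"
    using k_pos[OF \<open>x \<in> P\<close>] unfolding ell_rho by (simp add: field_simps)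
  ultimately have "k x * ell F (\<rho> x + x0) = 0"
    by (simp add: algebra_simps)
  then show ?thesis
    using k_pos[OF \<open>x \<in> P\<close>] by simp
qed

lemma q_rho: 
  assumes "G \<in> facets" "x \<in> P"
  shows "q G (\<rho> x) = 1 / k x - ell G x / (k x * ell G u)"
  using ell_u(2)[OF assms(1)] k_pos[OF assms(2)] unfolding q_def ell_rho by (simp add: field_simps)

lemma q_rho_le:
  assumes "G \<in> facets" "x \<in> P"
  shows "q G (\<rho> x) \<le> 1 / k x"
  using q_rho[OF assms] ell_u(2)[OF assms(1)] k_pos[OF assms(2)] ell_P[OF facetsD(1)[OF assms(1)] assms(2)]
  by simp

lemma q_rho_eq_iff:
  assumes "G \<in> facets" "x \<in> P"
  shows "q G (\<rho> x) = 1 / k x \<longleftrightarrow> x \<in> G"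
  using q_rho[OF assms] ell_u(2)[OF assms(1)] k_pos[OF assms(2)]
    ell_eq_0_iff[OF facetsD(1)[OF assms(1)] assms(2)] by simp

text \<open>At \<open>\<rho> x\<close> no \<open>q G'\<close> exceeds \<open>1 / k x\<close>, and
  the bound is attained exactly by the facets through \<open>x\<close>. Thus \<open>height\<close>,
  a maximum of affine functions, restricts to \<open>q G\<close> on the projection of
  \<open>G\<close>.\<close>

lemma height_rho:
  assumes "G \<in> facets" "x \<in> G"
  shows "height (\<rho> x) = 1 / k x"
proof -
  have "x \<in> P"
    using assms subset_P facetsD by blast
  then have "1 / k x = q G (\<rho> x)"
    using q_rho_eq_iff[OF assms(1) \<open>x \<in> P\<close>] assms(2) by metis
  then show ?thesis
    unfolding height_def using finite_facets q_rho_le[OF _ \<open>x \<in> P\<close>] assms(1)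
    by (intro Max_eqI) auto
qed

text \<open>The height of the image recovers the denominator \<open>k x\<close>, and the denominator
  together with \<open>\<rho> x\<close> recovers \<open>x\<close>.\<close>

lemma inj_on_rho: "inj_on \<rho> (\<Union>facets)"
proof (rule inj_onI)
  fix x y assume xy: "x \<in> \<Union>facets" "y \<in> \<Union>facets" "\<rho> x = \<rho> y"
  then have "k x = k y"
    using height_rho by (metis UnionE divide_cancel_left zero_neq_one)
  moreover have "x \<in> P"
    using xy(1) subset_P facetsD by blast
  ultimately show "x = y"
    using xy(3) k_pos[of x] by (simp add: \<rho>_def)
qed

text \<open>The projected point lies between \<open>u\<close> and a point of \<open>P\<close> and
  satisfies all facet inequalities, which gives one inclusion. For the other, follow the ray from
  \<open>u\<close> through a point of \<open>F\<close> until it leaves \<open>P\<close>: at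
  parameter \<open>s\<close> the function \<open>ell G'\<close> is
  \<open>(1 - s * q G' y) * ell G' u\<close>, so the exit parameter is
  \<open>1 / height y\<close>.\<close>

lemma rho_image: "\<rho> ` (\<Union>facets) = {x. x + x0 \<in> F}"
proof (intro equalityI subsetI)
  fix y assume "y \<in> \<rho> ` (\<Union>facets)"
  then obtain x G where x: "y = \<rho> x" "x \<in> G" "G \<in> facets"
    by blast
  then have "x \<in> P"
    using subset_P facetsD by blast
  have "ell G' (\<rho> x + x0) \<ge> 0" if G': "G' facet_of P" for G'
  proof (cases "G' = F")
    case False
    then have "G' \<in> facets"
      using G' by (simp add: facets_def)
    then have "ell G' u > 0"
      by (rule ell_u)
    then show ?thesis
      using k_pos[OF \<open>x \<in> P\<close>] ell_P[OF G' \<open>x \<in> P\<close>] by (simp add: ell_rho)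
  qed (use ell_F_rho[OF \<open>x \<in> P\<close>] in simp)
  then have "\<rho> x + x0 \<in> P"
    using mem_P_iff by blast
  then show "y \<in> {x. x + x0 \<in> F}"
    using ell_F_rho[OF \<open>x \<in> P\<close>] ell_eq_0_iff[OF F] x(1) by simp
next
  fix y assume "y \<in> {x. x + x0 \<in> F}"
  define x where "x = y + x0"
  have x: "x \<in> F" "x \<in> P" "ell F x = 0"
    using \<open>y \<in> _\<close> ell_eq_0_iff[OF F] subset_P[OF F] by (auto simp: x_def)
  have "x \<noteq> u"
    using x(3) ell_u(1) by auto
  define t where "t = height y"
  have "t \<in> (\<lambda>G. q G y) ` facets"
    unfolding t_def height_def using finite_facets facets_nonempty by (intro Max_in) auto
  then obtain G where G: "G \<in> facets" "q G y = t"
    by blast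
  have q_le: "q G' y \<le> t" if "G' \<in> facets" for G'
    unfolding t_def height_def using finite_facets that by (intro Max_ge) auto
  have ell_y: "ell G' x = (1 - q G' y) * ell G' u" if "G' \<in> facets" for G'
    using ell_u(2)[OF that] by (simp add: q_def x_def)
  have "t > 0"
  proof (rule ccontr)
    assume "\<not> t > 0"
    \<comment> \<open>If no \<open>q G' y\<close> is positive, the ray never leaves
      \<open>P\<close>, contrary to boundedness.\<close>
    have ray: "u + s *\<^sub>R (x - u) \<in> P" if "s \<ge> 1" for s
    proof -
      have "ell G' (u + s *\<^sub>R (x - u)) \<ge> 0" if "G' facet_of P" for G'
      proof (cases "G' = F")
        case True
        then show ?thesis
          using x(3) ell_u(1) \<open>s \<ge> 1\<close> unfolding ell_affine by (simp add: mult_nonpos_nonpos)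
      next
        case False
        then have G': "G' \<in> facets"
          using that by (simp add: facets_def)
        have "ell G' (u + s *\<^sub>R (x - u)) = (1 - s * q G' y) * ell G' u"
          unfolding ell_affine ell_y[OF G'] by (simp add: algebra_simps)
        moreover have "s * q G' y \<le> 0"
          using q_le[OF G'] \<open>\<not> t > 0\<close> \<open>s \<ge> 1\<close> by (simp add: mult_nonneg_nonpos)
        ultimately show ?thesis
          using ell_u(2)[OF G'] by simp
      qed
      then show ?thesis
        using mem_P_iff by blast
    qed
    obtain C where C: "\<And>y. y \<in> P \<Longrightarrow> norm y \<le> C"
      using polytope_imp_bounded[OF polytope] by (auto simp: bounded_iff)
    \<comment> \<open>Chosen so that the point at parameter \<open>s\<close> has norm at least
      \<open>\<bar>C\<bar> + norm (x - u)\<close>, which exceeds the bound \<open>C\<close>.\<close>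
    define s where "s = 1 + (\<bar>C\<bar> + norm u) / norm (x - u)"
    have "s \<ge> 1"
      by (simp add: s_def)
    have "norm (s *\<^sub>R (x - u)) = norm (x - u) + (\<bar>C\<bar> + norm u)"
      unfolding norm_scaleR using \<open>x \<noteq> u\<close> \<open>s \<ge> 1\<close> by (simp add: s_def field_simps)
    moreover have "norm (s *\<^sub>R (x - u)) \<le> norm (u + s *\<^sub>R (x - u)) + norm u"
      by (metis add_diff_cancel_left' norm_triangle_ineq4)
    moreover have "norm (x - u) > 0"
      using \<open>x \<noteq> u\<close> by simp
    ultimately show False
      using C[OF ray[OF \<open>s \<ge> 1\<close>]] by linarith
  qed
  have "t \<le> 1"
    using G ell_u(2)[OF G(1)] ell_P[OF facetsD(1)[OF G(1)] x(2)] by (simp add: q_def x_def[symmetric] flip: G(2))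
  \<comment> \<open>The exit point of the ray; it lies beyond or on the screen as
    \<open>t \<le> 1\<close>, and on the facet \<open>G\<close> that attains the maximum.\<close>
  define z where "z = u + (1 / t) *\<^sub>R (x - u)"
  have ell_z: "ell G' z = (1 - q G' y / t) * ell G' u" if "G' \<in> facets" for G'
    unfolding z_def ell_affine ell_y[OF that] using \<open>t > 0\<close> by (simp add: field_simps)
  have ell_F_z: "ell F z = (1 - 1 / t) * ell F u"
    unfolding z_def ell_affine x(3) by simp
  have "ell G' z \<ge> 0" if G': "G' facet_of P" for G'
  proof (cases "G' = F")
    case True
    then show ?thesis
      using ell_F_z \<open>t > 0\<close> \<open>t \<le> 1\<close> ell_u(1) by (simp add: mult_nonpos_nonpos)
  next
    case False
    then have "G' \<in> facets"
      using G' by (simp add: facets_def)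
    then have "q G' y / t \<le> 1" "ell G' u > 0"
      using q_le \<open>t > 0\<close> ell_u(2) by simp_all
    then show ?thesis
      using ell_z[OF \<open>G' \<in> facets\<close>] by simp
  qed
  then have "z \<in> P"
    using mem_P_iff by blast
  then have "z \<in> G"
    using ell_eq_0_iff[OF facetsD(1)[OF G(1)]] ell_z[OF G(1)] G(2) \<open>t > 0\<close> by simp
  have "k z = 1 / t"
    using ell_u(1) by (simp add: k_eq ell_F_z)
  then have "\<rho> z = y"
    using \<open>t > 0\<close> by (simp add: \<rho>_def z_def x_def)
  then show "y \<in> \<rho> ` (\<Union>facets)"
    using \<open>z \<in> G\<close> G(1) by blast
qed

section \<open>The projected facets as a simplicial complex\<close>

lemma facet_simplex:
  assumes "G \<in> facets"
  shows "\<not> affine_dependent (vertices_of G)" "convex hull (vertices_of G) = G"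
    "int (card (vertices_of G)) = int DIM('a)" "finite (vertices_of G)"
proof -
  obtain m where "m simplex G"
    using simplex facetsD[OF assms] by blast
  then obtain C where C: "\<not> affine_dependent C" "G = convex hull C"
    by (auto simp: simplex_def)
  have "vertices_of G = C"
    unfolding C(2) using C(1) by (simp add: vertices_of_convex_hull)
  then show V: "\<not> affine_dependent (vertices_of G)" "convex hull (vertices_of G) = G"
    using C by metis+
  have "aff_dim (vertices_of G) = int DIM('a) - 1"
    using facetsD(1)[OF assms] full_dim aff_dim_convex_hull[of "vertices_of G"]
    by (simp add: V(2) facet_of_def)
  then show "int (card (vertices_of G)) = int DIM('a)" "finite (vertices_of G)"
    using affine_independent_iff_card[of "vertices_of G"] V(1) by simp_all
qed

lemma vertices_of_subset:
  assumes "G \<in> facets"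
  shows "vertices_of G \<subseteq> G"
  using facet_simplex(2)[OF assms] hull_subset[of "vertices_of G" convex] by simp

lemma convex_hull_subset_facet:
  assumes "G \<in> facets" "c \<subseteq> vertices_of G"
  shows "convex hull c \<subseteq> G"
  using facet_simplex(2)[OF assms(1)] hull_mono[OF assms(2), of convex] by simp

lemma rho_convex_hull:
  assumes "G \<in> facets" "c \<subseteq> vertices_of G"
  shows "\<rho> ` (convex hull c) = convex hull (\<rho> ` c)"
proof -
  have "0 < inner ((1 / ell F u) *\<^sub>R a F) x + (1 - b F / ell F u)" if "x \<in> convex hull c" for x
    using k_pos[of x] convex_hull_subset_facet[OF assms] subset_P[OF facetsD(1)[OF assms(1)]] that
    unfolding k_def by force
  then show ?thesis
    using projective_convex_hull[of c "(1 / ell F u) *\<^sub>R a F" "1 - b F / ell F u" u "u - x0"]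
    by (simp only: \<rho>_def[abs_def] k_def)
qed

lemma inj_on_rho_vertices:
  assumes "G \<in> facets"
  shows "inj_on \<rho> (vertices_of G)"
  using inj_on_subset[OF inj_on_rho] vertices_of_subset[OF assms] assms by blast

text \<open>Dividing the coefficients of a dependence of the images by \<open>k\<close> gives a
  relation \<open>(\<Sum>v. d v *\<^sub>R v) = sum d *\<^sub>R u\<close>. The function
  \<open>ell G\<close> vanishes at the vertices of \<open>G\<close> but not at \<open>u\<close>, so
  the coefficients \<open>d\<close> sum to zero and form an affine dependence of the
  vertices.\<close>

lemma rho_independent:
  assumes "G \<in> facets"
  shows "\<not> affine_dependent (\<rho> ` vertices_of G)"
proof -
  let ?V = "vertices_of G"
  note V = facet_simplex[OF assms]
  have VG: "v \<in> P" "inner (a G) v = b G" if "v \<in> ?V" for v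
    using vertices_of_subset[OF assms] that facet_eq[OF facetsD(1)[OF assms]] by auto
  have "e v = 0" if e: "sum e (\<rho> ` ?V) = 0" "(\<Sum>v\<in>\<rho> ` ?V. e v *\<^sub>R v) = 0" and v: "v \<in> \<rho> ` ?V" for e v
  proof -
    define d where "d v = e (\<rho> v) / k v" for v
    have e0: "(\<Sum>v\<in>?V. e (\<rho> v)) = 0" "(\<Sum>v\<in>?V. e (\<rho> v) *\<^sub>R \<rho> v) = 0"
      using e by (simp_all add: sum.reindex[OF inj_on_rho_vertices[OF assms]])
    have "(\<Sum>v\<in>?V. e (\<rho> v) *\<^sub>R \<rho> v) = (\<Sum>v\<in>?V. d v *\<^sub>R v) - sum d ?V *\<^sub>R u + (\<Sum>v\<in>?V. e (\<rho> v)) *\<^sub>R (u - x0)"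
      by (simp add: \<rho>_def[of "_ :: 'a"] d_def algebra_simps scaleR_sum_left sum.distrib sum_subtractf
          del: e0)
    then have d_u: "(\<Sum>v\<in>?V. d v *\<^sub>R v) = sum d ?V *\<^sub>R u"
      using e0 by simp
    have "sum d ?V * inner (a G) u = inner (a G) (\<Sum>v\<in>?V. d v *\<^sub>R v)"
      by (simp add: d_u)
    also have "\<dots> = (\<Sum>v\<in>?V. d v * b G)"
      by (simp add: inner_sum_right VG)
    finally have "sum d ?V * ell G u = 0"
      by (simp add: ell_def sum_distrib_right right_diff_distrib)
    then have "sum d ?V = 0"
      using ell_u(2)[OF assms] by simp
    then have "\<forall>v\<in>?V. d v = 0"
      using V(1,4) d_u by (simp add: affine_dependent_explicit_finite) blast
    then show "e v = 0"
      using v k_pos VG(1) by (fastforce simp: d_def)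
  qed
  then show ?thesis
    using V(4) by (subst affine_dependent_explicit_finite) auto
qed

text \<open>The set \<open>c\<close> may be empty, because the empty set is a face of every simplex
  and a simplicial complex has to contain it.\<close>

definition K :: "'a set set" where
  "K = {convex hull (\<rho> ` c) | c G. G \<in> facets \<and> c \<subseteq> vertices_of G}"

definition A :: "'a set" where
  "A = \<rho> ` (\<Union>(vertices_of ` facets))"

lemma K_cases:
  assumes "S \<in> K"
  obtains G c where "G \<in> facets" "c \<subseteq> vertices_of G" "S = convex hull (\<rho> ` c)"
    "S = \<rho> ` (convex hull c)" "\<not> affine_dependent (\<rho> ` c)"
proof -
  obtain G c where Gc: "G \<in> facets" "c \<subseteq> vertices_of G" "S = convex hull (\<rho> ` c)"
    using assms by (auto simp: K_def)
  moreover have "\<not> affine_dependent (\<rho> ` c)"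
    using affine_independent_subset[OF rho_independent[OF Gc(1)]] Gc(2) by blast
  ultimately show thesis
    using that rho_convex_hull by metis
qed

lemma K_I: "G \<in> facets \<Longrightarrow> c \<subseteq> vertices_of G \<Longrightarrow> convex hull (\<rho> ` c) \<in> K"
  by (auto simp: K_def)

lemma rho_facet: "G \<in> facets \<Longrightarrow> \<rho> ` G = convex hull (\<rho> ` vertices_of G)"
  using rho_convex_hull[of G "vertices_of G"] facet_simplex(2)[of G] by simp

lemma finite_A: "finite A"
  using finite_facets facet_simplex(4) by (simp add: A_def)

text \<open>The intersection property comes from \<open>P\<close>: hulls of vertex subsets of
  simplicial facets are faces of \<open>P\<close>, two faces meet in a face, and injectivity of
  \<open>\<rho>\<close> transports the intersection.\<close>

lemma simplicial_complex_K: "simplicial_complex K"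
  unfolding simplicial_complex_def
proof (intro conjI ballI allI impI)
  have "K \<subseteq> (\<lambda>c. convex hull (\<rho> ` c)) ` Pow (\<Union>(vertices_of ` facets))"
    by (auto simp: K_def)
  then show "finite K"
    by (rule finite_subset) (use finite_facets facet_simplex(4) in simp)
next
  fix S assume "S \<in> K"
  then obtain G c where "S = convex hull (\<rho> ` c)" "\<not> affine_dependent (\<rho> ` c)"
    by (rule K_cases)
  then show "\<exists>m. m simplex S"
    unfolding simplex_def
    by (intro exI[of _ "int (card (\<rho> ` c)) - 1"] exI[of _ "\<rho> ` c"]) auto
next
  fix T S assume "S \<in> K \<and> T face_of S"
  then have "S \<in> K" and face: "T face_of S"
    by auto
  from this(1) obtain G c where Gc: "G \<in> facets" "c \<subseteq> vertices_of G" "S = convex hull (\<rho> ` c)"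
    "\<not> affine_dependent (\<rho> ` c)"
    by (rule K_cases)
  then obtain c' where "c' \<subseteq> \<rho> ` c" "T = convex hull c'"
    using face face_of_convex_hull_affine_independent by metis
  then obtain c'' where "c'' \<subseteq> c" "T = convex hull (\<rho> ` c'')"
    by (metis subset_imageE)
  then show "T \<in> K"
    using Gc K_I by auto
next
  fix S S' assume SS: "S \<in> K \<and> S' \<in> K"
  then obtain G c where Gc: "G \<in> facets" "c \<subseteq> vertices_of G" "S = convex hull (\<rho> ` c)"
    "S = \<rho> ` (convex hull c)" "\<not> affine_dependent (\<rho> ` c)"
    using K_cases by metis
  obtain G' c' where Gc': "G' \<in> facets" "c' \<subseteq> vertices_of G'" "S' = \<rho> ` (convex hull c')"
    using SS K_cases by metis
  have face: "convex hull c face_of P" if "G \<in> facets" "c \<subseteq> vertices_of G" for G c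
  proof -
    have "convex hull c face_of G"
      using face_of_convex_hull_affine_independent[OF facet_simplex(1)[OF that(1)]]
        facet_simplex(2)[OF that(1)] that(2) by metis
    then show ?thesis
      using face_of_trans facet_of_imp_face_of facetsD(1)[OF that(1)] by blast
  qed
  have "convex hull c \<inter> convex hull c' face_of P"
    using face Gc(1,2) Gc'(1,2) by (intro face_of_Int) auto
  then have "convex hull c \<inter> convex hull c' face_of convex hull c"
    using face[OF Gc(1,2)] by (simp add: face_of_face)
  then obtain c'' where c'': "c'' \<subseteq> c" "convex hull c \<inter> convex hull c' = convex hull c''"
    using face_of_convex_hull_affine_independent[of c] affine_independent_subset[OF facet_simplex(1)[OF Gc(1)] Gc(2)]
    by auto
  have "S \<inter> S' = \<rho> ` (convex hull c \<inter> convex hull c')"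
    unfolding Gc(4) Gc'(3)
    using inj_on_image_Int[OF inj_on_rho, of "convex hull c" "convex hull c'"]
      convex_hull_subset_facet[OF Gc(1,2)] convex_hull_subset_facet[OF Gc'(1,2)] Gc(1) Gc'(1)
    by (metis Sup_upper2)
  also have "\<dots> = convex hull (\<rho> ` c'')"
    unfolding c''(2) using rho_convex_hull[OF Gc(1)] c''(1) Gc(2) by blast
  finally show "S \<inter> S' face_of S"
    using face_of_convex_hull_affine_independent[OF Gc(5)] Gc(3) c''(1) by (metis image_mono)
qed

lemma Union_K_rho: "\<Union>K = \<rho> ` (\<Union>facets)"
proof
  show "\<Union>K \<subseteq> \<rho> ` (\<Union>facets)"
  proof
    fix x assume "x \<in> \<Union>K"
    then obtain S where "S \<in> K" "x \<in> S"
      by blast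
    from this(1) obtain G c where "G \<in> facets" "c \<subseteq> vertices_of G" "S = \<rho> ` (convex hull c)"
      by (rule K_cases)
    then show "x \<in> \<rho> ` (\<Union>facets)"
      using \<open>x \<in> S\<close> convex_hull_subset_facet by blast
  qed
  show "\<rho> ` (\<Union>facets) \<subseteq> \<Union>K"
    using rho_facet K_I by fastforce
qed

text \<open>By \<open>rho_image\<close> the union is a translate of \<open>F\<close>, hence convex,
  so it contains the hull of the projected vertices.\<close>

lemma Union_K: "\<Union>K = convex hull A"
proof
  have "A \<subseteq> \<Union>K"
    unfolding Union_K_rho A_def using vertices_of_subset by blast
  moreover have "convex {x. x + x0 \<in> F}"
  proof -
    have "{x. x + x0 \<in> F} = (\<lambda>x. - x0 + x) ` F"
      by (force simp: image_iff)
    then show ?thesis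
      using F convex_translation facet_of_imp_face_of face_of_imp_convex by metis
  qed
  ultimately show "convex hull A \<subseteq> \<Union>K"
    by (intro hull_minimal) (simp_all add: Union_K_rho rho_image)
  show "\<Union>K \<subseteq> convex hull A"
  proof (rule Union_least)
    fix S assume "S \<in> K"
    then obtain G c where "G \<in> facets" "c \<subseteq> vertices_of G" "S = convex hull (\<rho> ` c)"
      by (rule K_cases)
    then show "S \<subseteq> convex hull A"
      by (auto simp: A_def intro!: hull_mono)
  qed
qed

lemma triangulation_K: "triangulation_of K A"
  unfolding triangulation_of_def
proof (intro conjI ballI)
  fix S assume "S \<in> K"
  then obtain G c where Gc: "G \<in> facets" "c \<subseteq> vertices_of G" "S = convex hull (\<rho> ` c)"
    "\<not> affine_dependent (\<rho> ` c)"
    by (rule K_cases)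
  then show "vertices_of S \<subseteq> A"
    by (auto simp: A_def vertices_of_convex_hull)
qed (simp_all add: simplicial_complex_K Union_K)

definition E :: "'a set" where
  "E = {x. inner (a F) x = 0}"

lemma rho_in_E: "x \<in> P \<Longrightarrow> \<rho> x \<in> E"
proof -
  assume "x \<in> P"
  have "inner (a F) x0 = b F"
    using x0 facet_eq[OF F] by blast
  then show ?thesis
    using ell_F_rho[OF \<open>x \<in> P\<close>] by (simp add: E_def ell_def inner_add_right)
qed

lemma A_subset_E: "A \<subseteq> E"
  unfolding A_def using rho_in_E vertices_of_subset facetsD subset_P by blast

lemma affine_hull_rho_facet:
  assumes "G \<in> facets"
  shows "affine hull (\<rho> ` G) = E"
proof (rule affine_dim_equal)
  have "\<rho> ` G \<subseteq> E"
    using rho_in_E facetsD(1)[OF assms] subset_P by blast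
  moreover have "affine E"
    unfolding E_def by (rule affine_hyperplane)
  ultimately show "affine hull (\<rho> ` G) \<subseteq> E" "affine E"
    by (simp_all add: hull_minimal)
  show "affine hull (\<rho> ` G) \<noteq> {}"
    using facetsD(1)[OF assms] by (simp add: facet_of_def)
  have "aff_dim E = int DIM('a) - 1"
    using a_nz by (simp add: E_def)
  moreover have "card (\<rho> ` vertices_of G) = card (vertices_of G)"
    by (rule card_image[OF inj_on_rho_vertices[OF assms]])
  then have "aff_dim (\<rho> ` vertices_of G) = int DIM('a) - 1"
    using affine_independent_iff_card[of "\<rho> ` vertices_of G"] rho_independent[OF assms] facet_simplex(3)[OF assms]
    by simp
  ultimately show "aff_dim (affine hull (\<rho> ` G)) = aff_dim E"
    using rho_facet[OF assms] by (simp add: aff_dim_convex_hull)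
qed simp

text \<open>Injectivity of \<open>\<rho>\<close> turns an inclusion of projected facets into one of
  facets, and distinct facets are never nested.\<close>

lemma maximal_K: "maximal_simplices K = (\<lambda>G. \<rho> ` G) ` facets"
proof (intro equalityI subsetI)
  fix S assume S: "S \<in> maximal_simplices K"
  then have "S \<in> K"
    by (simp add: maximal_simplices_def)
  then obtain G c where Gc: "G \<in> facets" "c \<subseteq> vertices_of G" "S = \<rho> ` (convex hull c)"
    by (rule K_cases)
  then have "S \<subseteq> \<rho> ` G"
    using convex_hull_subset_facet by blast
  moreover have "\<rho> ` G \<in> K"
    using rho_facet K_I Gc(1) by auto
  ultimately show "S \<in> (\<lambda>G. \<rho> ` G) ` facets"
    using S Gc(1) by (auto simp: maximal_simplices_def)
next
  fix S assume "S \<in> (\<lambda>G. \<rho> ` G) ` facets"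
  then obtain G where G: "G \<in> facets" "S = \<rho> ` G"
    by blast
  have "T = S" if "T \<in> K" "S \<subseteq> T" for T
  proof -
    from \<open>T \<in> K\<close> obtain G' c where Gc: "G' \<in> facets" "c \<subseteq> vertices_of G'" "T = \<rho> ` (convex hull c)"
      by (rule K_cases)
    have "\<rho> ` G \<subseteq> \<rho> ` (convex hull c)"
      using that(2) G(2) Gc(3) by simp
    then have "G \<subseteq> convex hull c"
      using inj_on_image_subset_iff[OF inj_on_rho, of G "convex hull c"]
        convex_hull_subset_facet[OF Gc(1,2)] G(1) Gc(1) by blast
    moreover have "convex hull c \<subseteq> G'"
      by (rule convex_hull_subset_facet[OF Gc(1,2)])
    ultimately have "G = G'"
      using facet_subset_imp_eq[OF facetsD(1)[OF G(1)] facetsD(1)[OF Gc(1)]] by blast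
    then show ?thesis
      using G Gc \<open>G \<subseteq> convex hull c\<close> \<open>convex hull c \<subseteq> G'\<close> by blast
  qed
  moreover have "S \<in> K"
    using rho_facet K_I G by auto
  ultimately show "S \<in> maximal_simplices K"
    by (auto simp: maximal_simplices_def)
qed

lemma q_affine: "q G x = inner ((1 / ell G u) *\<^sub>R a G) x + (1 - ell G x0 / ell G u)"
  by (simp add: q_def ell_def inner_add_right diff_divide_distrib add_divide_distrib algebra_simps)

text \<open>If \<open>height\<close> were affine on the images of two facets \<open>G\<close> and
  \<open>G'\<close>, the affine function would agree with \<open>q G\<close> on all of
  \<open>E\<close>, since the image of \<open>G\<close> spans \<open>E\<close>. So
  \<open>q G\<close> would attain the maximum on the image of \<open>G'\<close> as well, which puts
  \<open>G'\<close> inside \<open>G\<close>.\<close>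

lemma regular_K: "regular_triangulation_of K A"
  unfolding regular_triangulation_of_def
proof (intro conjI exI[of _ height] ballI impI)
  show "triangulation_of K A"
    by (rule triangulation_K)
  show "convex_on (convex hull A) height"
  proof (rule convex_onI)
    fix t x y assume t: "0 < t" "t < (1::real)"
    have "q G ((1 - t) *\<^sub>R x + t *\<^sub>R y) \<le> (1 - t) * height x + t * height y" if "G \<in> facets" for G
    proof -
      have "q G ((1 - t) *\<^sub>R x + t *\<^sub>R y) = (1 - t) * q G x + t * q G y"
      proof -
        have "(1 - t) * X + t * Y + d = (1 - t) * (X + d) + t * (Y + d)" for X Y d
          by (simp add: algebra_simps)
        then show ?thesis
          by (simp only: q_affine inner_add_right inner_scaleR_right)
      qed
      moreover have "q G x \<le> height x" for x
        unfolding height_def using finite_facets that by (intro Max_ge) auto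
      ultimately show ?thesis
        using t by (simp add: add_mono)
    qed
    then show "height ((1 - t) *\<^sub>R x + t *\<^sub>R y) \<le> (1 - t) * height x + t * height y"
      using finite_facets facets_nonempty unfolding height_def[of "(1 - t) *\<^sub>R x + t *\<^sub>R y"]
      by (subst Max_le_iff) auto
  qed simp
next
  fix S assume "S \<in> K"
  then obtain G c where Gc: "G \<in> facets" "c \<subseteq> vertices_of G" "S = \<rho> ` (convex hull c)"
    by (rule K_cases)
  have "height x = inner ((1 / ell G u) *\<^sub>R a G) x + (1 - ell G x0 / ell G u)" if x: "x \<in> S" for x
  proof -
    obtain y where y: "y \<in> G" "x = \<rho> y"
      using x Gc(3) convex_hull_subset_facet[OF Gc(1,2)] by blast
    then have "y \<in> P"
      using subset_P facetsD(1)[OF Gc(1)] by blast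
    then show ?thesis
      unfolding q_affine[symmetric]
      using height_rho[OF Gc(1) y(1)] q_rho_eq_iff[OF Gc(1) \<open>y \<in> P\<close>] y by simp
  qed
  then show "affine_function_on S height"
    unfolding affine_function_on_def using bounded_linear.linear[OF bounded_linear_inner_right] by blast
next
  fix S T assume ST: "S \<in> maximal_simplices K" "T \<in> maximal_simplices K" "S \<noteq> T"
  then obtain G G' where G: "G \<in> facets" "G' \<in> facets" "S = \<rho> ` G" "T = \<rho> ` G'"
    by (auto simp: maximal_K)
  show "\<not> affine_function_on (S \<union> T) height"
  proof
    assume "affine_function_on (S \<union> T) height"
    then obtain l c where lc: "linear l" "\<And>x. x \<in> S \<union> T \<Longrightarrow> height x = l x + c"
      unfolding affine_function_on_def by blast
    have GP: "G \<subseteq> P" "G' \<subseteq> P"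
      using G(1,2) facetsD(1) subset_P by blast+
    have "affine {x. q G x = l x + c}"
      unfolding q_affine using bounded_linear.linear[OF bounded_linear_inner_right] lc(1)
      by (rule affine_linear_eq)
    moreover have "\<rho> ` G \<subseteq> {x. q G x = l x + c}"
      using lc(2) G(3) height_rho[OF G(1)] q_rho_eq_iff[OF G(1)] GP(1) by fastforce
    ultimately have E: "E \<subseteq> {x. q G x = l x + c}"
      using hull_minimal affine_hull_rho_facet[OF G(1)] by metis
    have "y \<in> G" if "y \<in> G'" for y
    proof -
      have "y \<in> P"
        using that GP(2) by blast
      then have "q G (\<rho> y) = l (\<rho> y) + c"
        using E rho_in_E by blast
      moreover have "height (\<rho> y) = l (\<rho> y) + c"
        using that G(4) by (intro lc(2)) blast
      ultimately have "q G (\<rho> y) = height (\<rho> y)"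
        by simp
      then show ?thesis
        using q_rho_eq_iff[OF G(1) \<open>y \<in> P\<close>] height_rho[OF G(2) that] by simp
    qed
    then have "G' = G"
      using facet_subset_imp_eq facetsD(1) G(1,2) by blast
    then show False
      using ST(3) G by simp
  qed
qed

lemma regular_complex_facets:
  assumes e: "DIM('a) = Suc e" and f: "inj_on f (\<Union>\<Delta>)" "(`) f ` \<Delta> \<subseteq> vertices_of ` facets"
  shows "regular_complex TYPE('a) e \<Delta>"
  unfolding regular_complex_def
proof (intro exI conjI)
  show "subspace E"
    unfolding E_def by (rule subspace_hyperplane)
  show "dim E = e"
    using dim_hyperplane[OF a_nz] e by (simp add: E_def)
  show "finite A" "A \<subseteq> E" "regular_triangulation_of K A"
    by (rule finite_A A_subset_E regular_K)+
  show "isomorphic_to_subcomplex \<Delta> (vertices_of ` maximal_simplices K)"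
    unfolding isomorphic_to_subcomplex_def
  proof (intro exI conjI)
    have "f ` (\<Union>\<Delta>) \<subseteq> \<Union>facets"
    proof
      fix x assume "x \<in> f ` (\<Union>\<Delta>)"
      then obtain \<sigma> where "\<sigma> \<in> \<Delta>" "x \<in> f ` \<sigma>"
        by blast
      then obtain G where "G \<in> facets" "x \<in> vertices_of G"
        using f(2) by blast
      then show "x \<in> \<Union>facets"
        using vertices_of_subset by blast
    qed
    then show "inj_on (\<rho> \<circ> f) (\<Union>\<Delta>)"
      using f(1) inj_on_rho by (auto intro: comp_inj_on inj_on_subset)
    have "\<rho> ` vertices_of G = vertices_of (\<rho> ` G)" if "G \<in> facets" for G
      using rho_independent[OF that] rho_facet[OF that]
      by (simp add: vertices_of_convex_hull)
    note rho_vertices = this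
    have "(\<rho> \<circ> f) ` \<sigma> \<in> vertices_of ` maximal_simplices K" if \<sigma>: "\<sigma> \<in> \<Delta>" for \<sigma>
    proof -
      obtain G where G: "G \<in> facets" "f ` \<sigma> = vertices_of G"
        using f(2) \<sigma> by blast
      then have "(\<rho> \<circ> f) ` \<sigma> = vertices_of (\<rho> ` G)"
        unfolding image_comp[symmetric] using rho_vertices by simp
      then show ?thesis
        using G(1) by (simp add: maximal_K)
    qed
    then show "(`) (\<rho> \<circ> f) ` \<Delta> \<subseteq> vertices_of ` maximal_simplices K"
      by blast
  qed
qed

end

section \<open>Regular complexes and liftings\<close>

text \<open>An empty \<open>\<Delta>\<close> supplies no facet besides the screen, so the Schlegel
  construction cannot be started; the empty configuration takes its place.\<close>

lemma regular_complex_empty: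
  assumes "e \<le> DIM('a::euclidean_space)"
  shows "regular_complex TYPE('a) e {}"
proof -
  obtain E :: "'a set" where "subspace E" "dim E = e"
    using choose_subspace_of_subspace[of e "UNIV :: 'a set"] assms by auto
  moreover have "regular_triangulation_of {} ({} :: 'a set)"
    by (simp add: regular_triangulation_of_def triangulation_of_def simplicial_complex_def
        maximal_simplices_def convex_on_def)
  ultimately show ?thesis
    unfolding regular_complex_def isomorphic_to_subcomplex_def
    by (intro exI[of _ E] exI[of _ "{}"]) auto
qed

text \<open>A relative interior point \<open>x0\<close> of \<open>F\<close> lies on no other facet.
  Moving from \<open>x0\<close> directly away from a point \<open>z\<close> of \<open>P\<close>
  outside \<open>F\<close> goes beyond \<open>F\<close> at once, and a short move stays beneath the
  finitely many other facets.\<close>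

lemma regular_complex_if_facets:
  fixes P :: "'a::euclidean_space set"
  assumes P: "polytope P" "aff_dim P = int DIM('a)" and F: "F facet_of P"
    and simplex: "\<And>G. G facet_of P \<Longrightarrow> G \<noteq> F \<Longrightarrow> \<exists>k. k simplex G"
    and e: "DIM('a) = Suc e"
    and f: "inj_on f (\<Union>\<Delta>)" "(`) f ` \<Delta> \<subseteq> vertices_of ` {G. G facet_of P \<and> G \<noteq> F}"
  shows "regular_complex TYPE('a) e \<Delta>"
proof (cases "\<Delta> = {}")
  case True
  then show ?thesis
    using regular_complex_empty[where 'a = 'a] e by simp
next
  case False
  then have other: "\<exists>G. G facet_of P \<and> G \<noteq> F"
    using f(2) by blast
  have poly: "polyhedron P"
    using P(1) polytope_imp_polyhedron by blast
  have "\<exists>a b. G facet_of P \<longrightarrow> a \<noteq> 0 \<and> P \<subseteq> {x. inner a x \<le> b} \<and> G = P \<inter> {x. inner a x = b}" for G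
    using facet_of_polyhedron[OF poly, of G] by metis
  then obtain a b where ab: "\<And>G. G facet_of P \<Longrightarrow>
      a G \<noteq> 0 \<and> P \<subseteq> {x. inner (a G) x \<le> b G} \<and> G = P \<inter> {x. inner (a G) x = b G}"
    by metis
  have facet_mem: "x \<in> G \<longleftrightarrow> x \<in> P \<and> inner (a G) x = b G" if "G facet_of P" for G x
    using ab[OF that] by blast
  have face_F: "F face_of P" "convex F" "F \<noteq> {}" "F \<subseteq> P"
    using F by (auto simp: facet_of_def face_of_imp_convex face_of_imp_subset)
  obtain x0 where x0: "x0 \<in> rel_interior F"
    using face_F(2,3) rel_interior_eq_empty by blast
  then have "x0 \<in> F"
    using rel_interior_subset by blast
  have x0_G: "inner (a G) x0 < b G" if "G facet_of P" "G \<noteq> F" for G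
  proof -
    have "x0 \<notin> G"
    proof
      assume "x0 \<in> G"
      then have "F \<subseteq> G"
        using subset_of_face_of[of G P F] x0 face_F(4) facet_of_imp_face_of[OF that(1)] by blast
      then show False
        using facet_subset_imp_eq[OF F that(1)] that(2) by blast
    qed
    then show ?thesis
      using facet_mem[OF that(1)] ab[OF that(1)] \<open>x0 \<in> F\<close> face_F(4) by (metis (mono_tags, lifting) in_mono mem_Collect_eq order_le_less)
  qed
  have "F \<noteq> P"
    using F by (auto simp: facet_of_def)
  then obtain z where z: "z \<in> P" "z \<notin> F"
    using face_F(4) by blast
  have z_F: "inner (a F) z < b F"
    using z facet_mem[OF F] ab[OF F] by (metis (mono_tags, lifting) in_mono mem_Collect_eq order_le_less)
  define u where "u t = x0 + t *\<^sub>R (x0 - z)" for t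
  have "\<forall>\<^sub>F t in at_right 0. inner (a G) (u t) < b G" if "G \<in> {G. G facet_of P \<and> G \<noteq> F}" for G
  proof -
    have "((\<lambda>t. inner (a G) (u t)) \<longlongrightarrow> inner (a G) (x0 + 0 *\<^sub>R (x0 - z))) (at_right 0)"
      unfolding u_def by (intro tendsto_intros)
    then show ?thesis
      using x0_G that by (intro order_tendstoD(2)) auto
  qed
  moreover have "finite {G. G facet_of P \<and> G \<noteq> F}"
    using finite_polytope_facets[OF P(1)] by simp
  ultimately have "\<forall>\<^sub>F t in at_right 0. \<forall>G\<in>{G. G facet_of P \<and> G \<noteq> F}. inner (a G) (u t) < b G"
    by (intro eventually_ball_finite) blast+
  then have "\<forall>\<^sub>F t in at_right 0. (\<forall>G\<in>{G. G facet_of P \<and> G \<noteq> F}. inner (a G) (u t) < b G) \<and> t > 0"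
    using eventually_at_right_less eventually_conj by blast
  then obtain t where t: "\<forall>G\<in>{G. G facet_of P \<and> G \<noteq> F}. inner (a G) (u t) < b G" "t > (0::real)"
    using eventually_happens trivial_limit_at_right_real by blast
  have "inner (a F) x0 = b F"
    using facet_mem[OF F] \<open>x0 \<in> F\<close> by blast
  then have "inner (a F) (u t) > b F"
    using z_F t(2) by (simp add: u_def inner_add_right inner_diff_right)
  interpret point_beyond_facet P F x0 "u t" a b
  proof
    show "G = {x \<in> P. inner (a G) x = b G}" if "G facet_of P" for G
      using facet_mem[OF that] by blast
    show "inner (a G) x \<le> b G" if "G facet_of P" "x \<in> P" for G x
      using ab[OF that(1)] that(2) by blast
    show "a F \<noteq> 0"
      using ab[OF F] by blast
    show "\<exists>k. k simplex G" if "G facet_of P" "G \<noteq> F" for G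
      using that by (rule simplex)
    show "inner (a G) (u t) < b G" if "G facet_of P" "G \<noteq> F" for G
      using t(1) that by blast
  qed (fact P F \<open>x0 \<in> F\<close> \<open>inner (a F) (u t) > b F\<close> other)+
  show ?thesis
    using f by (intro regular_complex_facets e) (auto simp: facets_def)
qed

text \<open>Passage from local to global: convexity puts \<open>h\<close> weakly above the affine
  function of \<open>S\<close>. Equality at a vertex \<open>v\<close> outside \<open>S\<close> would
  spread to the hull of \<open>S\<close> and \<open>v\<close>, which overlaps a second maximal
  simplex in full dimension, and \<open>h\<close> would be affine on the union of both.\<close>

lemma regular_triangulation_strict:
  fixes A :: "'a::euclidean_space set"
  assumes tri: "triangulation_of K A" and h: "convex_on (convex hull A) h"
    and pl: "\<forall>S\<in>K. affine_function_on S h"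
    and reg: "\<forall>S\<in>maximal_simplices K. \<forall>T\<in>maximal_simplices K.
        S \<noteq> T \<longrightarrow> \<not> affine_function_on (S \<union> T) h"
    and E: "A \<subseteq> E" "affine E"
    and S: "S \<in> maximal_simplices K" "aff_dim S = aff_dim E"
    and v: "T \<in> K" "v \<in> vertices_of T" "v \<notin> vertices_of S"
    and l: "linear l" "\<forall>x\<in>S. h x = l x + c"
  shows "l v + c < h v"
proof -
  have complex: "simplicial_complex K" and UK: "\<Union>K = convex hull A"
    using tri by (auto simp: triangulation_of_def)
  have K: "finite K" "\<And>T. T \<in> K \<Longrightarrow> closed T \<and> convex T \<and> T \<subseteq> convex hull A"
      "\<And>T F. T \<in> K \<Longrightarrow> F face_of T \<Longrightarrow> F \<in> K"
      "\<And>T T'. T \<in> K \<Longrightarrow> T' \<in> K \<Longrightarrow> T \<inter> T' face_of T"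
    using complex closed_simplex convex_simplex UK unfolding simplicial_complex_def by (metis, metis Union_upper, metis, metis)
  have AE: "convex hull A \<subseteq> E"
    using E by (intro hull_minimal affine_imp_convex)
  have SK: "S \<in> K"
    using S(1) by (simp add: maximal_simplices_def)
  have vT: "v \<in> T"
    using v(2) by (simp add: vertices_of_def extreme_point_of_def)
  then have vA: "v \<in> convex hull A"
    using K(2) v(1) by blast
  then have "E \<noteq> {}"
    using AE by blast
  then have "S \<noteq> {}"
    using S(2) by (metis aff_dim_empty)
  have hull_S: "affine hull S = E"
  proof (rule affine_dim_equal)
    show "affine hull S \<subseteq> E"
      using K(2)[OF SK] AE E(2) by (intro hull_minimal) auto
  qed (use S(2) E(2) \<open>S \<noteq> {}\<close> in simp_all)
  have ge: "l x + c \<le> h x" if "x \<in> convex hull A" for x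
  proof -
    \<comment> \<open>The segment from \<open>x\<close> to \<open>y\<close> can be prolonged to a
      point \<open>z\<close> of \<open>S\<close>. So \<open>y\<close> lies strictly between
      \<open>x\<close> and \<open>z\<close>, and convexity at \<open>y\<close>, with
      \<open>h\<close> known at \<open>y\<close> and \<open>z\<close>, bounds \<open>h x\<close>
      from below.\<close>
    obtain y where y: "y \<in> rel_interior S"
      using \<open>S \<noteq> {}\<close> K(2)[OF SK] rel_interior_eq_empty by blast
    have "x \<in> affine hull S"
      using that AE hull_S by blast
    then obtain m where m: "m > 1" "(1 - m) *\<^sub>R x + m *\<^sub>R y \<in> S"
      using convex_rel_interior_iff2[of S y] y K(2)[OF SK] \<open>S \<noteq> {}\<close> by blast
    define z where "z = (1 - m) *\<^sub>R x + m *\<^sub>R y"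
    define s where "s = (m - 1) / m"
    have s: "0 < s" "s < 1" "1 - s = 1 / m"
      using m(1) by (simp_all add: s_def field_simps)
    have "s *\<^sub>R x + (1 - s) *\<^sub>R z = (s + (1 - m) / m) *\<^sub>R x + y"
      using m(1) by (simp add: s(3) z_def scaleR_add_right scaleR_add_left)
    also have "s + (1 - m) / m = 0"
      by (simp add: s_def flip: add_divide_distrib)
    finally have y_eq: "y = s *\<^sub>R x + (1 - s) *\<^sub>R z"
      by simp
    have zS: "z \<in> S" and yS: "y \<in> S"
      using m(2) y rel_interior_subset by (auto simp: z_def)
    have "h y \<le> s * h x + (1 - s) * h z"
      using h that zS K(2)[OF SK] s unfolding convex_on_def y_eq
      by (metis add.commute diff_add_cancel diff_ge_0_iff_ge less_imp_le subsetD)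
    moreover have "h y = s * (l x) + (1 - s) * (l z) + c"
      using l(2) yS by (simp add: y_eq linear_add[OF l(1)] linear_cmul[OF l(1)])
    moreover have "h z = l z + c"
      using l(2) zS by blast
    ultimately have "s * (l x + c) \<le> s * h x"
      by (simp add: algebra_simps)
    then show ?thesis
      using s(1) by simp
  qed
  \<comment> \<open>The face \<open>{v}\<close> of \<open>T\<close> belongs to \<open>K\<close>; if
    it met \<open>S\<close>, it would be a face of \<open>S\<close>, and \<open>v\<close> a vertex
    of \<open>S\<close>.\<close>
  have vS: "v \<notin> S"
  proof
    assume "v \<in> S"
    have "{v} face_of T"
      using v(2) by (simp add: vertices_of_def face_of_singleton)
    then have "{v} \<in> K"
      using K(3) v(1) by blast
    then have "S \<inter> {v} face_of S"
      using K(4) SK by blast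
    then have "{v} face_of S"
      using \<open>v \<in> S\<close> by simp
    then show False
      using v(3) by (simp add: vertices_of_def face_of_singleton)
  qed
  show ?thesis
  proof (rule ccontr)
    assume "\<not> l v + c < h v"
    define Z where "Z = convex hull (insert v S)"
    have "convex {x \<in> convex hull A. h x \<le> l x + c}"
    proof (rule convexI)
      fix x y and \<alpha> \<beta> :: real
      assume x: "x \<in> {x \<in> convex hull A. h x \<le> l x + c}" and y: "y \<in> {x \<in> convex hull A. h x \<le> l x + c}"
        and \<alpha>\<beta>: "0 \<le> \<alpha>" "0 \<le> \<beta>" "\<alpha> + \<beta> = 1"
      have "h (\<alpha> *\<^sub>R x + \<beta> *\<^sub>R y) \<le> \<alpha> * h x + \<beta> * h y"
        using h x y \<alpha>\<beta> by (simp add: convex_on_def)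
      also have "\<dots> \<le> \<alpha> * (l x + c) + \<beta> * (l y + c)"
        using x y \<alpha>\<beta> by (intro add_mono mult_left_mono) auto
      also have "\<dots> = l (\<alpha> *\<^sub>R x + \<beta> *\<^sub>R y) + (\<alpha> + \<beta>) * c"
        by (simp add: linear_add[OF l(1)] linear_cmul[OF l(1)] algebra_simps)
      finally show "\<alpha> *\<^sub>R x + \<beta> *\<^sub>R y \<in> {x \<in> convex hull A. h x \<le> l x + c}"
        using x y \<alpha>\<beta> by (simp add: convexD[OF convex_convex_hull])
    qed
    moreover have "insert v S \<subseteq> {x \<in> convex hull A. h x \<le> l x + c}"
      using vA K(2)[OF SK] l(2) \<open>\<not> l v + c < h v\<close> by auto
    ultimately have "Z \<subseteq> {x \<in> convex hull A. h x \<le> l x + c}"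
      unfolding Z_def by (intro hull_minimal)
    then have Z: "Z \<subseteq> convex hull A" "\<And>x. x \<in> Z \<Longrightarrow> h x = l x + c"
      using ge by (force intro: antisym)+
    have hull_Z: "affine hull Z = E"
    proof
      show "affine hull Z \<subseteq> E"
        using Z(1) AE E(2) by (intro hull_minimal) auto
      have "S \<subseteq> Z"
        unfolding Z_def using hull_subset[of "insert v S" convex] by blast
      then show "E \<subseteq> affine hull Z"
        using hull_S hull_mono by blast
    qed
    \<comment> \<open>Relatively open in \<open>E\<close>, and nonempty: otherwise the closed set
      \<open>S\<close> would contain the closure of the relative interior of \<open>Z\<close>, and
      with it \<open>v\<close>.\<close>
    define X where "X = rel_interior Z \<inter> - S"
    have X_open: "openin (top_of_set E) X"
      unfolding X_def using openin_rel_interior[of Z] K(2)[OF SK]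
      by (intro openin_Int_open) (auto simp: hull_Z open_Compl)
    have "X \<noteq> {}"
    proof
      assume "X = {}"
      then have "closure (rel_interior Z) \<subseteq> S"
        using K(2)[OF SK] by (intro closure_minimal) (auto simp: X_def)
      moreover have "convex Z" "v \<in> Z"
        by (auto simp: Z_def hull_inc)
      ultimately show False
        using vS convex_closure_rel_interior[of Z] closure_subset by blast
    qed
    \<comment> \<open>A closed set of smaller dimension has a dense complement in a relatively open
      set spanning \<open>E\<close>, so the simplices of smaller dimension can be removed one by one
      without exhausting \<open>X\<close>.\<close>
    have "openin (top_of_set E) (X - \<Union>\<F>) \<and> X - \<Union>\<F> \<noteq> {}"
      if "finite \<F>" "\<And>T. T \<in> \<F> \<Longrightarrow> closed T \<and> aff_dim T < aff_dim E" for \<F>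
      using that
    proof (induction \<F> rule: finite_induct)
      case empty
      then show ?case
        using X_open \<open>X \<noteq> {}\<close> by simp
    next
      case (insert T \<F>)
      then have IH: "openin (top_of_set E) (X - \<Union>\<F>)" "X - \<Union>\<F> \<noteq> {}" and T: "closed T" "aff_dim T < aff_dim E"
        by auto
      have eq: "X - \<Union>(insert T \<F>) = (X - \<Union>\<F>) \<inter> - T"
        by blast
      have "affine hull (X - \<Union>\<F>) = E"
        using affine_hull_openin[of E "X - \<Union>\<F>"] IH E(2) by (simp add: hull_same)
      moreover from this have "aff_dim (X - \<Union>\<F>) = aff_dim E"
        by (metis aff_dim_affine_hull)
      ultimately have "closure (X - \<Union>\<F> - T) = closure (X - \<Union>\<F>)"
        using T(2) IH by (intro dense_complement_openin_affine_hull) auto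
      then have "X - \<Union>(insert T \<F>) \<noteq> {}"
        using IH(2) by (metis Diff_eq closure_eq_empty eq)
      moreover have "openin (top_of_set E) (X - \<Union>(insert T \<F>))"
        unfolding eq using IH(1) T(1) by (intro openin_Int_open) (auto simp: open_Compl)
      ultimately show ?case
        by blast
    qed
    then have "X - \<Union>{T \<in> K. aff_dim T < aff_dim E} \<noteq> {}"
      by (rule conjunct2) (use K(1,2) in auto)
    then obtain x where x: "x \<in> X" "\<And>T. T \<in> K \<Longrightarrow> x \<in> T \<Longrightarrow> \<not> aff_dim T < aff_dim E"
      by blast
    have "x \<in> Z"
      using x(1) rel_interior_subset by (auto simp: X_def)
    then obtain T where T: "T \<in> K" "x \<in> T"
      using Z(1) UK by blast
    have le: "aff_dim T' \<le> aff_dim E" if "T' \<in> K" for T'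
      using K(2)[OF that] AE by (intro aff_dim_subset) auto
    then have dimT: "aff_dim T = aff_dim E"
      using x(2)[OF T] T(1) by (simp add: antisym_conv2)
    have hull_T: "affine hull T = E"
      proof (rule affine_dim_equal)
      show "affine hull T \<subseteq> E"
        using K(2)[OF T(1)] AE E(2) by (intro hull_minimal) auto
    qed (use dimT E(2) T(2) in auto)
    have "T \<noteq> S"
      using x(1) T(2) by (auto simp: X_def)
    have T_max: "T \<in> maximal_simplices K"
      unfolding maximal_simplices_def
    proof (intro CollectI conjI ballI impI)
      fix T' assume T': "T' \<in> K" "T \<subseteq> T'"
      have "T face_of T'"
        using K(4)[OF T'(1) T(1)] T'(2) by (simp add: Int_absorb1)
      then show "T' = T"
        using face_of_aff_dim_lt[of T' T] K(2)[OF T'(1)] le[OF T'(1)] dimT by fastforce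
    qed (rule T(1))
    obtain U where U: "open U" "X = E \<inter> U"
      using X_open by (auto simp: openin_open)
    \<comment> \<open>Although \<open>x\<close> may lie on the boundary of \<open>T\<close>, the
      open set around it meets the relative interior of \<open>T\<close>. The overlap is relatively
      open and spans \<open>E\<close>, so the affine functions of \<open>S\<close> and
      \<open>T\<close> agree on \<open>E\<close>.\<close>
    have "x \<in> closure (rel_interior T)"
      using convex_closure_rel_interior[of T] K(2)[OF T(1)] T(2) closure_subset by blast
    then have "U \<inter> rel_interior T \<noteq> {}"
      using open_Int_closure_eq_empty[OF U(1)] x(1) U(2) by blast
    moreover have "rel_interior T \<subseteq> E"
      using rel_interior_subset[of T] hull_subset[of T affine] hull_T by simp
    ultimately have ne: "rel_interior T \<inter> U \<noteq> {}" and sub: "rel_interior T \<inter> U \<subseteq> X \<inter> T"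
      using U(2) rel_interior_subset[of T] by blast+
    have "openin (top_of_set (affine hull T)) (rel_interior T \<inter> U)"
      using openin_rel_interior U(1) by (rule openin_Int_open)
    then have hull_O: "affine hull (rel_interior T \<inter> U) = E"
      using affine_hull_openin ne hull_T by metis
    obtain l' c' where l': "linear l'" "\<forall>x\<in>T. h x = l' x + c'"
      using pl T(1) unfolding affine_function_on_def by blast
    have "rel_interior T \<inter> U \<subseteq> {x. l x + c = l' x + c'}"
    proof
      fix y assume "y \<in> rel_interior T \<inter> U"
      then have "y \<in> T" "y \<in> Z"
        using sub rel_interior_subset[of Z] by (auto simp: X_def)
      then show "y \<in> {x. l x + c = l' x + c'}"
        using l'(2) Z(2) by auto
    qed
    then have "E \<subseteq> {x. l x + c = l' x + c'}"
      unfolding hull_O[symmetric] by (rule hull_minimal) (rule affine_linear_eq[OF l(1) l'(1)])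
    then have "\<forall>x\<in>T. h x = l x + c"
      using l'(2) hull_subset[of T affine] hull_T by fastforce
    then have "affine_function_on (S \<union> T) h"
      unfolding affine_function_on_def using l by blast
    then show False
      using reg S(1) T_max \<open>T \<noteq> S\<close> by blast
  qed
qed

text \<open>\<open>E\<close> has codimension 1, so there is a unit normal \<open>w\<close> along
  which to lift. The affine function of a maximal simplex becomes a nonvertical hyperplane below the
  lifted points, and \<open>regular_triangulation_strict\<close> supplies the strictness.\<close>

lemma facet_config_if_regular:
  assumes e: "DIM('a::euclidean_space) = Suc e" and reg: "regular_complex TYPE('a) e \<Delta>"
    and \<Delta>: "finite \<Delta>" "\<And>\<sigma>. \<sigma> \<in> \<Delta> \<Longrightarrow> card \<sigma> = Suc e"
  shows "\<exists>p :: nat \<Rightarrow> 'a. \<forall>\<sigma>\<in>\<Delta>. facet_config I p \<sigma>"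
proof -
  obtain E A :: "'a set" and K where
    E: "subspace E" "dim E = e" and A: "A \<subseteq> E" and KA: "regular_triangulation_of K A"
    and iso: "isomorphic_to_subcomplex \<Delta> (vertices_of ` maximal_simplices K)"
    using reg unfolding regular_complex_def by (elim exE conjE) (rule that)
  obtain h where tri: "triangulation_of K A"
    and h: "convex_on (convex hull A) h" "\<forall>S\<in>K. affine_function_on S h"
      "\<forall>S\<in>maximal_simplices K. \<forall>T\<in>maximal_simplices K. S \<noteq> T \<longrightarrow> \<not> affine_function_on (S \<union> T) h"
    using KA unfolding regular_triangulation_of_def by (elim exE conjE) (rule that)
  obtain f where f: "inj_on f (\<Union>\<Delta>)" "(`) f ` \<Delta> \<subseteq> vertices_of ` maximal_simplices K"
    using iso unfolding isomorphic_to_subcomplex_def by (elim exE conjE) (rule that)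
  obtain w' where w': "w' \<noteq> 0" "\<And>y. y \<in> span E \<Longrightarrow> inner w' y = 0"
    using orthogonal_to_subspace_exists[of E] E(2) e by (auto simp: real_inner_class.orthogonal_def)
  define w where "w = (1 / norm w') *\<^sub>R w'"
  have w: "inner w w = 1" "inner w x = 0" "inner x w = 0" if "x \<in> E" for x
    using w'(1) w'(2)[OF span_base[OF that]]
    by (simp_all add: w_def dot_square_norm power2_eq_square inner_commute)
  have ww: "inner w w = 1"
    using w(1) subspace_0[OF E(1)] by blast
  have fE: "f i \<in> E" if \<sigma>: "\<sigma> \<in> \<Delta>" and i: "i \<in> \<sigma>" for \<sigma> i
  proof -
    have "f ` \<sigma> \<in> vertices_of ` maximal_simplices K"
      using f(2) \<sigma> by blast
    then obtain S where "S \<in> K" "f ` \<sigma> = vertices_of S"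
      by (auto simp: maximal_simplices_def)
    then show ?thesis
      using tri A i unfolding triangulation_of_def by blast
  qed
  have "\<exists>g c. (\<forall>i\<in>\<sigma>. h (f i) = inner g (f i) + c) \<and> (\<forall>i\<in>\<Union>\<Delta> - \<sigma>. inner g (f i) + c < h (f i)) \<and>
      aff_dim (f ` \<sigma>) = int e"
    if \<sigma>: "\<sigma> \<in> \<Delta>" for \<sigma>
  proof -
    obtain S where S: "S \<in> maximal_simplices K" "f ` \<sigma> = vertices_of S"
      using f(2) \<sigma> by blast
    then have "S \<in> K"
      by (simp add: maximal_simplices_def)
    then obtain m C where C: "\<not> affine_dependent C" "S = convex hull C"
      using tri unfolding triangulation_of_def simplicial_complex_def simplex_def by meson
    then have VC: "f ` \<sigma> = C"
      using S(2) vertices_of_convex_hull by metis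
    have "card (f ` \<sigma>) = Suc e"
      using \<Delta>(2)[OF \<sigma>] card_image[of f \<sigma>] inj_on_subset[OF f(1)] \<sigma> by (metis Sup_upper)
    then have dim: "aff_dim (f ` \<sigma>) = int e"
      using affine_independent_iff_card[of C] C(1) VC by simp
    then have "aff_dim S = aff_dim E"
      using C(2) VC E aff_dim_subspace[OF E(1)] by (simp add: aff_dim_convex_hull)
    obtain l c where l: "linear l" "\<forall>x\<in>S. h x = l x + c"
      using h(2) \<open>S \<in> K\<close> unfolding affine_function_on_def by blast
    obtain g where g: "\<And>x. l x = inner g x"
      using linear_functional_inner[OF l(1)] by blast
    have "h (f i) = inner g (f i) + c" if "i \<in> \<sigma>" for i
    proof -
      have "f i \<in> S"
        using that VC C(2) hull_subset[of C convex] by blast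
      then show ?thesis
        using l(2) g by simp
    qed
    moreover have "inner g (f i) + c < h (f i)" if i: "i \<in> \<Union>\<Delta> - \<sigma>" for i
    proof -
      obtain \<sigma>' where \<sigma>': "\<sigma>' \<in> \<Delta>" "i \<in> \<sigma>'"
        using i by blast
      then obtain T where T: "T \<in> K" "f i \<in> vertices_of T"
        using f(2) unfolding maximal_simplices_def by blast
      have "f i \<notin> f ` \<sigma>"
        using inj_on_image_mem_iff[OF f(1), of i \<sigma>] i \<sigma> by blast
      then have "l (f i) + c < h (f i)"
        using regular_triangulation_strict[OF tri h A subspace_imp_affine[OF E(1)] S(1) \<open>aff_dim S = aff_dim E\<close> T _ l]
          S(2) by simp
      then show ?thesis
        using g by simp
    qed
    ultimately show ?thesis
      using dim by blast
  qed
  then obtain g c where gc: "\<And>\<sigma> i. \<sigma> \<in> \<Delta> \<Longrightarrow> i \<in> \<sigma> \<Longrightarrow> h (f i) = inner (g \<sigma>) (f i) + c \<sigma>"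
    "\<And>\<sigma> i. \<sigma> \<in> \<Delta> \<Longrightarrow> i \<in> \<Union>\<Delta> - \<sigma> \<Longrightarrow> inner (g \<sigma>) (f i) + c \<sigma> < h (f i)"
    "\<And>\<sigma>. \<sigma> \<in> \<Delta> \<Longrightarrow> aff_dim (f ` \<sigma>) = int e"
    by metis
  \<comment> \<open>The point \<open>H *\<^sub>R w\<close> lies over the origin of \<open>E\<close>,
    where the affine function of \<open>\<sigma>\<close> has the value
    \<open>c \<sigma>\<close>.\<close>
  obtain H where H: "\<And>\<sigma>. \<sigma> \<in> \<Delta> \<Longrightarrow> c \<sigma> < H"
  proof
    fix \<sigma> assume "\<sigma> \<in> \<Delta>"
    then have "c \<sigma> \<le> Max (c ` \<Delta>)"
      using \<Delta>(1) by simp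
    then show "c \<sigma> < Max (c ` \<Delta>) + 1"
      by simp
  qed
  \<comment> \<open>indices that occur in no facet are lifted to a single high point\<close>
  define p where "p i = (if i \<in> \<Union>\<Delta> then f i + h (f i) *\<^sub>R w else H *\<^sub>R w)" for i
  have "facet_config I p \<sigma>" if \<sigma>: "\<sigma> \<in> \<Delta>" for \<sigma>
  proof -
    \<comment> \<open>The component of \<open>g \<sigma>\<close> along \<open>w\<close> is replaced
      by \<open>- 1\<close>, so that \<open>a\<close> evaluates the affine part at the foot of a
      point and subtracts its height.\<close>
    define a where "a = g \<sigma> - (inner (g \<sigma>) w + 1) *\<^sub>R w"
    have a: "inner a (x + t *\<^sub>R w) = inner (g \<sigma>) x - t" if "x \<in> E" for x t
      using w[OF that] by (simp add: a_def inner_diff_left inner_add_right algebra_simps)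
    have "inner a (p i) = - c \<sigma>" if "i \<in> \<sigma>" for i
    proof -
      have "p i = f i + h (f i) *\<^sub>R w"
        using that \<sigma> by (auto simp: p_def)
      then show ?thesis
        using gc(1)[OF \<sigma> that] by (simp add: a[OF fE[OF \<sigma> that]])
    qed
    moreover have "inner a (p i) < - c \<sigma>" if "i \<in> I - \<sigma>" for i
    proof (cases "i \<in> \<Union>\<Delta>")
      case True
      then obtain \<sigma>' where \<sigma>': "\<sigma>' \<in> \<Delta>" "i \<in> \<sigma>'"
        by blast
      have "p i = f i + h (f i) *\<^sub>R w"
        using True by (simp add: p_def)
      then show ?thesis
        using gc(2)[OF \<sigma>, of i] True that by (simp add: a[OF fE[OF \<sigma>']])
    next
      case False
      then have "p i = 0 + H *\<^sub>R w"
        unfolding p_def by simp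
      then have "inner a (p i) = - H"
        using a[OF subspace_0[OF E(1)], of H] by (simp only:) simp
      then show ?thesis
        using H[OF \<sigma>] by simp
    qed
    moreover have "aff_dim (p ` \<sigma>) = int DIM('a) - 1"
    proof -
      \<comment> \<open>Projecting back along \<open>w\<close> recovers the simplex and bounds the
        dimension from below; the number of points bounds it from above.\<close>
      define \<pi> where "\<pi> x = x - inner w x *\<^sub>R w" for x
      have "linear \<pi>"
        unfolding \<pi>_def by (intro linearI) (simp_all add: inner_add_right algebra_simps)
      have "\<pi> (p i) = f i" if "i \<in> \<sigma>" for i
      proof -
        have "p i = f i + h (f i) *\<^sub>R w"
          using that \<sigma> by (auto simp: p_def)
        then show ?thesis
          using w(2)[OF fE[OF \<sigma> that]] ww by (simp add: \<pi>_def inner_add_right)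
      qed
      then have "\<pi> ` p ` \<sigma> = f ` \<sigma>"
        by (auto simp: image_iff)
      then have "int e \<le> aff_dim (p ` \<sigma>)"
        using aff_dim_linear_image_le[OF \<open>linear \<pi>\<close>, of "p ` \<sigma>"] gc(3)[OF \<sigma>] by simp
      moreover have "finite \<sigma>"
        using \<Delta>(2)[OF \<sigma>] by (metis card.infinite nat.distinct(1))
      then have "aff_dim (p ` \<sigma>) \<le> int e"
        using aff_dim_le_card[of "p ` \<sigma>"] card_image_le[of \<sigma> p] \<Delta>(2)[OF \<sigma>] by simp
      ultimately show ?thesis
        using e by simp
    qed
    ultimately show ?thesis
      unfolding facet_config_def by blast
  qed
  then show ?thesis
    by blast
qed

theorem corollary4p7:
  fixes n d :: nat and \<Gamma> :: "nat set set"
  assumes "nd_complex n d \<Gamma>"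
    and "n \<ge> d + 2"
    and "DIM('a::euclidean_space) = n - d - 1"
  shows "(regular_complex TYPE('a) (n - d - 2) (complement_complex n \<Gamma>)
            \<longrightarrow> positively_decorable n d \<Gamma>) \<and>
         (positively_decorable n d \<Gamma> \<longrightarrow>
            (regular_complex TYPE('a) (n - d - 2) (complement_complex n \<Gamma>) \<or>
             simplicial_polytope_boundary TYPE('a) (complement_complex n \<Gamma>)) \<and>
            (simplicial_polytope_boundary TYPE('a) (complement_complex n \<Gamma>) \<longrightarrow>
              (\<forall>\<sigma>\<in>complement_complex n \<Gamma>.
                 regular_complex TYPE('a) (n - d - 2) (complement_complex n \<Gamma> - {\<sigma>}))))"
proof -
  let ?\<Delta> = "complement_complex n \<Gamma>" and ?e = "n - d - 2"
  have e: "DIM('a) = Suc ?e"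
    using assms(2,3) by simp
  have \<Delta>: "finite ?\<Delta>" "\<And>\<sigma>. \<sigma> \<in> ?\<Delta> \<Longrightarrow> \<sigma> \<subseteq> {1..n} \<and> card \<sigma> = DIM('a)"
    "\<And>\<tau>. \<tau> \<in> \<Gamma> \<Longrightarrow> {1..n} - \<tau> \<in> ?\<Delta>"
    using assms(1,3) by (auto simp: complement_complex_def nd_complex_def card_Diff_subset finite_subset)
  have "positively_decorable n d \<Gamma>" if reg: "regular_complex TYPE('a) ?e ?\<Delta>"
  proof -
    have "card \<sigma> = Suc ?e" if "\<sigma> \<in> ?\<Delta>" for \<sigma>
      using \<Delta>(2)[OF that] e by simp
    then obtain p :: "nat \<Rightarrow> 'a" where "\<forall>\<sigma>\<in>?\<Delta>. facet_config {1..n} p \<sigma>"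
      using facet_config_if_regular[OF e reg \<Delta>(1)] by blast
    then have "\<exists>c. \<forall>\<tau>\<in>\<Gamma>. spans_positively d c \<tau>"
      using \<Delta>(3) by (intro spans_positively_if_facet_config[OF assms(1,3,2)]) blast
    then show ?thesis
      using positively_decorable_iff[OF assms(1)] by blast
  qed
  moreover have "regular_complex TYPE('a) ?e ?\<Delta> \<or> simplicial_polytope_boundary TYPE('a) ?\<Delta>"
    if "positively_decorable n d \<Gamma>"
  proof -
    obtain c where "\<forall>\<tau>\<in>\<Gamma>. spans_positively d c \<tau>"
      using \<open>positively_decorable n d \<Gamma>\<close> positively_decorable_iff[OF assms(1)] by blast
    then obtain p :: "nat \<Rightarrow> 'a" where "\<forall>\<tau>\<in>\<Gamma>. facet_config {1..n} p ({1..n} - \<tau>)"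
      using facet_config_if_spans_positively[OF assms(1,3,2)] by blast
    then have "\<forall>\<sigma>\<in>?\<Delta>. facet_config {1..n} p \<sigma>"
      by (auto simp: complement_complex_def)
    then obtain q :: "nat \<Rightarrow> 'a" where q: "\<forall>\<sigma>\<in>?\<Delta>. facet_config {1..n} q \<sigma>" "general_position {1..n} q"
      using facet_config_perturb[of "{1..n}" ?\<Delta> p] \<Delta>(1,2) by blast
    have I: "finite {1..n}" "Suc DIM('a) \<le> card {1..n}"
      using assms(2,3) by auto
    note gp = I q(2)
    let ?P = "convex hull (q ` {1..n})"
    have P: "simplicial_polytope ?P" "aff_dim ?P = int DIM('a)"
      using general_position_simplicial_polytope[OF gp] general_position_aff_dim_hull[OF gp] by auto
    have facet: "convex hull (q ` \<sigma>) facet_of ?P" "vertices_of (convex hull (q ` \<sigma>)) = q ` \<sigma>" if "\<sigma> \<in> ?\<Delta>" for \<sigma>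
      using facet_config_imp_facet[OF gp] q(1) \<Delta>(2) that by auto
    have inj: "inj_on q (\<Union>?\<Delta>)"
      using inj_on_subset[OF general_position_inj[OF gp]] \<Delta>(2) by blast
    show ?thesis
    proof (cases "\<forall>G. G facet_of ?P \<longrightarrow> (\<exists>\<sigma>\<in>?\<Delta>. G = convex hull (q ` \<sigma>))")
      case True
      have "(`) q ` ?\<Delta> = vertices_of ` {F. F facet_of ?P}"
      proof (intro equalityI subsetI)
        fix V assume "V \<in> (`) q ` ?\<Delta>"
        then obtain \<sigma> where \<sigma>: "\<sigma> \<in> ?\<Delta>" "V = q ` \<sigma>"
          by blast
        then have "V = vertices_of (convex hull (q ` \<sigma>))"
          using facet(2) by simp
        then show "V \<in> vertices_of ` {F. F facet_of ?P}"
          using facet(1)[OF \<sigma>(1)] by blast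
      next
        fix V assume "V \<in> vertices_of ` {F. F facet_of ?P}"
        then obtain G where G: "G facet_of ?P" "V = vertices_of G"
          by blast
        then obtain \<sigma> where "\<sigma> \<in> ?\<Delta>" "G = convex hull (q ` \<sigma>)"
          using True by blast
        then show "V \<in> (`) q ` ?\<Delta>"
          using G(2) facet(2) by simp
      qed
      then have "simplicial_polytope_boundary TYPE('a) ?\<Delta>"
        unfolding simplicial_polytope_boundary_def isomorphic_complexes_def using P inj by blast
      then show ?thesis ..
    next
      case False
      then obtain F where F: "F facet_of ?P" "\<And>\<sigma>. \<sigma> \<in> ?\<Delta> \<Longrightarrow> F \<noteq> convex hull (q ` \<sigma>)"
        by blast
      have "(`) q ` ?\<Delta> \<subseteq> vertices_of ` {G. G facet_of ?P \<and> G \<noteq> F}"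
      proof
        fix V assume "V \<in> (`) q ` ?\<Delta>"
        then obtain \<sigma> where \<sigma>: "\<sigma> \<in> ?\<Delta>" "V = q ` \<sigma>"
          by blast
        then have "V = vertices_of (convex hull (q ` \<sigma>))"
          using facet(2) by simp
        then show "V \<in> vertices_of ` {G. G facet_of ?P \<and> G \<noteq> F}"
          using facet(1)[OF \<sigma>(1)] F(2)[OF \<sigma>(1)] by blast
      qed
      then have "regular_complex TYPE('a) ?e ?\<Delta>"
        using P F(1) e inj unfolding simplicial_polytope_def by (intro regular_complex_if_facets) auto
      then show ?thesis ..
    qed
  qed
  moreover have "regular_complex TYPE('a) ?e (?\<Delta> - {\<sigma>})"
    if boundary: "simplicial_polytope_boundary TYPE('a) ?\<Delta>" and \<sigma>: "\<sigma> \<in> ?\<Delta>" for \<sigma>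
  proof -
    obtain P :: "'a set" and f where P: "simplicial_polytope P" "aff_dim P = int DIM('a)"
      and f: "inj_on f (\<Union>?\<Delta>)" "(`) f ` ?\<Delta> = vertices_of ` {F. F facet_of P}"
      using boundary unfolding simplicial_polytope_boundary_def isomorphic_complexes_def by blast
    \<comment> \<open>The facet \<open>F\<close> labelled by the omitted \<open>\<sigma>\<close>
      serves as the screen; injectivity of \<open>f\<close> keeps all other labels away from
      it.\<close>
    have "f ` \<sigma> \<in> vertices_of ` {F. F facet_of P}"
      unfolding f(2)[symmetric] using \<sigma> by (rule imageI)
    then obtain F where F: "F facet_of P" "f ` \<sigma> = vertices_of F"
      by blast
    have "(`) f ` (?\<Delta> - {\<sigma>}) \<subseteq> vertices_of ` {G. G facet_of P \<and> G \<noteq> F}"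
    proof
      fix V assume "V \<in> (`) f ` (?\<Delta> - {\<sigma>})"
      then obtain \<sigma>' where \<sigma>': "\<sigma>' \<in> ?\<Delta>" "\<sigma>' \<noteq> \<sigma>" "V = f ` \<sigma>'"
        by blast
      then have "V \<in> vertices_of ` {F. F facet_of P}"
        unfolding f(2)[symmetric] by blast
      then obtain G where G: "G facet_of P" "V = vertices_of G"
        by blast
      have "G \<noteq> F"
      proof
        assume "G = F"
        then have "f ` \<sigma>' = f ` \<sigma>"
          using G(2) F(2) \<sigma>'(3) by simp
        then show False
          using inj_on_image_eq_iff[OF f(1), of \<sigma>' \<sigma>] \<sigma>' \<sigma> by blast
      qed
      then show "V \<in> vertices_of ` {G. G facet_of P \<and> G \<noteq> F}"
        using G by blast
    qed
    moreover have "inj_on f (\<Union>(?\<Delta> - {\<sigma>}))"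
      using f(1) by (rule inj_on_subset) blast
    ultimately show ?thesis
      using P F(1) e unfolding simplicial_polytope_def by (intro regular_complex_if_facets) auto
  qed
  ultimately show ?thesis
    by blast
qed

end
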